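(* Let $d\ge 2$ and $e\ge 1$ be integers. Suppose that $PIC(d,e)$ holds, i.e. that in $\mathbb{Q}[x_1,\ldots,x_e]$ the ideal $\mathrm{rad}(g_{d,e},g_{d+1,e},\ldots,g_{d+e-1,e})$ is a maximal ideal and $a_{d,e}\notin \mathrm{rad}(g_{d,e},g_{d+1,e},\ldots,g_{d+e-2,e})$. Then $\mathcal{G}_{(d+e)}\subset\overline{\mathcal{G}_{(d,e+1)}}$.
   Context: Automorphisms. $\mathcal{G}$ is the group of polynomial automorphisms of the affine plane $\mathbb{C}^2$, written as pairs $(F_1,F_2)\in\mathbb{C}[X,Y]^2$, with group law the composition of maps. $\mathcal{A}\subset\mathcal{G}$ is the subgroup of affine (degree one) automorphisms, and $\mathcal{B}\subset\mathcal{G}$ is the triangular subgroup of automorphisms $(aX+P(Y),bY+c)$ with $a,b\in\mathbb{C}^*$, $c\in\mathbb{C}$, $P\in\mathbb{C}[Y]$. By the Jung-van der Kulk theorem every $\theta\in\mathcal{G}$ can be written $\theta=\alpha_0\tau_1\alpha_1\cdots\tau_k\alpha_k$ with $\alpha_i\in\mathcal{A}$, and $\tau_i\in\mathcal{B}\setminus\mathcal{A}$, reduced in the sense of the amalgamated free product $\mathcal{A}*_{\mathcal{A}\cap\mathcal{B}}\mathcal{B}$ (that is, $\alpha_i\notin\mathcal{B}$ for $0<i<k$); then the sequence $(\deg\tau_1,\ldots,\deg\tau_k)$ depends only on $\theta$ and is called the polydegree of $\theta$ (degree of an automorphism = maximum of the degrees of its components). $\mathcal{G}_{(d_1,\ldots,d_k)}$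 is the set of automorphisms of polydegree $(d_1,\ldots,d_k)$. Topology. $\mathcal{G}$ is an ind-variety: $\mathcal{G}=\bigcup_n\mathcal{G}_{\le n}$, where $\mathcal{G}_{\le n}$ is the set of automorphisms of degree at most $n$, a locally closed subset of the finite-dimensional space of pairs of polynomials of degree at most $n$. A subset of $\mathcal{G}$ is closed iff its intersection with every $\mathcal{G}_{\le n}$ is Zariski closed in $\mathcal{G}_{\le n}$. $\overline{A}$ denotes the closure of $A\subset\mathcal{G}$ in this topology. Polynomials. For a sequence $\mathbf{a}=(a_1,\ldots,a_e)$ of nonnegative integers put $|\mathbf{a}|=a_1+\cdots+a_e$ and $\mathbf{a}\cdot\mathbb{N}=a_1+2a_2+\cdots+ea_e$; $\binom{|\mathbf{a}|+m}{\mathbf{a},m}=\frac{(|\mathbf{a}|+m)!}{a_1!\cdots a_e!\,m!}$. Define in $\mathbb{Q}[x_1,\ldots,x_e]$ $$g_{d,e}=\frac{1}{d+1}\sum_{\mathbf{a}\cdot\mathbb{N}=d}(-1)^{|\mathbf{a}|}\binom{d+|\mathbf{a}|}{\mathbf{a},d}x_1^{a_1}\cdots x_e^{a_e},\qquad \alpha_{i,j,e}=\sum_{\mathbf{a}\cdot\mathbb{N}=j-i}(-1)^{|\mathbf{a}|}\binom{|\mathbf{a}|+j+2}{\mathbf{a},j+2}x_1^{a_1}\cdots x_e^{a_e}$$ (so $\alpha_{i,j,e}=0$ if $j<i$), and let $a_{d,e}$ be the determinant of the $e\times e$ matrix $$a_{d,e}=\det\big(\alpha_{i,j,e}\ \big|\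 0\le i\le e-1,\ d-1\le j\le d+e-2\big).$$ $\mathrm{rad}$ denotes the radical of the ideal generated by the listed elements (the zero ideal if the list is empty, as happens for $g_{d,e},\ldots,g_{d+e-2,e}$ when $e=1$). *)

theory Defs
  imports
    "HOL-Library.Poly_Mapping"
    "HOL-Algebra.Ideal"
    "Jordan_Normal_Form.Determinant"
begin

section \<open>Polynomials in arbitrarily many variables\<close>

text \<open>A polynomial maps exponent vectors to coefficients, both with finite support; the ring
  operations are those of \<^theory>\<open>HOL-Library.Poly_Mapping\<close>.\<close>

type_synonym ('v, 'a) mpol = "('v \<Rightarrow>\<^sub>0 nat) \<Rightarrow>\<^sub>0 'a"

definition mpol_vars :: "('v, 'a::zero) mpol \<Rightarrow> 'v set" where
  "mpol_vars p = (\<Union>m \<in> Poly_Mapping.keys p. Poly_Mapping.keys m)"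

definition mpol_eval :: "('v \<Rightarrow> 'a) \<Rightarrow> ('v, 'a::comm_semiring_1) mpol \<Rightarrow> 'a" where
  "mpol_eval s p = (\<Sum>m \<in> Poly_Mapping.keys p.
     Poly_Mapping.lookup p m * (\<Prod>v \<in> Poly_Mapping.keys m. s v ^ Poly_Mapping.lookup m v))"

definition mpol_ring :: "'v set \<Rightarrow> ('v, 'a::comm_ring_1) mpol ring" where
  "mpol_ring V =
     \<lparr>carrier = {p. mpol_vars p \<subseteq> V}, monoid.mult = (*), one = 1, zero = 0, add = (+)\<rparr>"

lemma mpol_vars_add: "mpol_vars (p + q) \<subseteq> mpol_vars p \<union> mpol_vars q"
  unfolding mpol_vars_def using Poly_Mapping.keys_add[of p q] by fast

lemma mpol_vars_mult: "mpol_vars (p * q) \<subseteq> mpol_vars p \<union> mpol_vars q"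
proof
  fix v assume "v \<in> mpol_vars (p * q)"
  then obtain m where m: "m \<in> Poly_Mapping.keys (p * q)" "v \<in> Poly_Mapping.keys m"
    unfolding mpol_vars_def by blast
  then obtain a b where
    "m = a + b" "a \<in> Poly_Mapping.keys p" "b \<in> Poly_Mapping.keys q"
    using Poly_Mapping.keys_mult[of p q] by blast
  with m(2) show "v \<in> mpol_vars p \<union> mpol_vars q"
    unfolding mpol_vars_def using Poly_Mapping.keys_add[of a b] by fast
qed

lemma mpol_vars_uminus: "mpol_vars (- p) = mpol_vars (p :: ('v, 'a::comm_ring_1) mpol)"
  unfolding mpol_vars_def by (simp add: Poly_Mapping.in_keys_iff set_eq_iff)

lemma cring_mpol_ring: "cring (mpol_ring V :: ('v, 'a::comm_ring_1) mpol ring)"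
proof (intro cringI abelian_groupI comm_monoidI)
  fix p :: "('v, 'a) mpol" assume "p \<in> carrier (mpol_ring V)"
  then show "\<exists>q \<in> carrier (mpol_ring V). q \<oplus>\<^bsub>mpol_ring V\<^esub> p = \<zero>\<^bsub>mpol_ring V\<^esub>"
    by (intro bexI[of _ "- p"]) (auto simp: mpol_ring_def mpol_vars_uminus)
next
  fix p q :: "('v, 'a) mpol"
  assume "p \<in> carrier (mpol_ring V)" "q \<in> carrier (mpol_ring V)"
  then show "p \<oplus>\<^bsub>mpol_ring V\<^esub> q \<in> carrier (mpol_ring V)"
    "p \<otimes>\<^bsub>mpol_ring V\<^esub> q \<in> carrier (mpol_ring V)"
    using mpol_vars_add[of p q] mpol_vars_mult[of p q] by (auto simp: mpol_ring_def)
qed (auto simp: mpol_ring_def mpol_vars_def algebra_simps)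

definition rad :: "('b, 'm) ring_scheme \<Rightarrow> 'b set \<Rightarrow> 'b set" where
  "rad R S = {x \<in> carrier R. \<exists>n::nat. n > 0 \<and> x [^]\<^bsub>R\<^esub> n \<in> Idl\<^bsub>R\<^esub> S}"

section \<open>The polynomials $g_{d,e}$, $\alpha_{i,j,e}$, $a_{d,e}$ and the condition $PIC(d,e)$\<close>

text \<open>The sequence $(a_1,\dots,a_e)$ is the exponent vector \<open>a\<close> with support in \<open>{1..e}\<close>,
  so that $x_1^{a_1}\cdots x_e^{a_e}$ with coefficient \<open>c\<close> is \<open>Poly_Mapping.single a c\<close>.\<close>

definition exps :: "nat \<Rightarrow> (nat \<Rightarrow>\<^sub>0 nat) set" where
  "exps e = {a. Poly_Mapping.keys a \<subseteq> {1..e}}"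

definition esize :: "nat \<Rightarrow> (nat \<Rightarrow>\<^sub>0 nat) \<Rightarrow> nat" where
  "esize e a = (\<Sum>i = 1..e. Poly_Mapping.lookup a i)"

definition eweight :: "nat \<Rightarrow> (nat \<Rightarrow>\<^sub>0 nat) \<Rightarrow> nat" where
  "eweight e a = (\<Sum>i = 1..e. i * Poly_Mapping.lookup a i)"

definition multinom :: "nat \<Rightarrow> (nat \<Rightarrow>\<^sub>0 nat) \<Rightarrow> nat \<Rightarrow> rat" where
  "multinom e a m = fact (esize e a + m) / ((\<Prod>i = 1..e. fact (Poly_Mapping.lookup a i)) * fact m)"

definition g_pol :: "nat \<Rightarrow> nat \<Rightarrow> (nat, rat) mpol" where
  "g_pol d e = (\<Sum>a \<in> {a \<in> exps e. eweight e a = d}.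
     Poly_Mapping.single a (1 / of_nat (d + 1) * (- 1) ^ esize e a * multinom e a d))"

definition alpha_pol :: "nat \<Rightarrow> nat \<Rightarrow> nat \<Rightarrow> (nat, rat) mpol" where
  "alpha_pol i j e = (\<Sum>a \<in> {a \<in> exps e. i + eweight e a = j}.
     Poly_Mapping.single a ((- 1) ^ esize e a * multinom e a (j + 2)))"

definition a_pol :: "nat \<Rightarrow> nat \<Rightarrow> (nat, rat) mpol" where
  "a_pol d e = det (mat e e (\<lambda>(i, k). alpha_pol i (d - 1 + k) e))"

definition PIC :: "nat \<Rightarrow> nat \<Rightarrow> bool" where
  "PIC d e \<longleftrightarrow>
     (let R = mpol_ring {1..e} in
        maximalideal (rad R ((\<lambda>k. g_pol k e) ` {d..<d + e})) R \<and>
        a_pol d e \<notin> rad R ((\<lambda>k. g_pol k e) ` {d..<d + e - 1}))"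

section \<open>Polynomial automorphisms of the affine plane\<close>

text \<open>The ring $\mathbb{C}[X,Y]$ is read as $\mathbb{C}[Y][X]$: the coefficient of $X^iY^j$ in
  \<open>P\<close> is \<open>coeff (coeff P i) j\<close>.\<close>

type_synonym xypoly = "complex poly poly"
type_synonym pmap = "xypoly \<times> xypoly"

definition xy_subst :: "xypoly \<Rightarrow> pmap \<Rightarrow> xypoly" where
  "xy_subst P F =
     poly (map_poly (\<lambda>q. poly (map_poly (\<lambda>c. [:[:c:]:]) q) (snd F)) P) (fst F)"

definition pmap_id :: pmap where
  "pmap_id = ([:0, 1:], [:[:0, 1:]:])"

definition pmap_comp :: "pmap \<Rightarrow> pmap \<Rightarrow> pmap"  (infixl \<open>\<odot>\<close> 70) where
  "F \<odot> G = (xy_subst (fst F) G, xy_subst (snd F) G)"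

definition GA :: "pmap set" where
  "GA = {F. \<exists>G. F \<odot> G = pmap_id \<and> G \<odot> F = pmap_id}"

text \<open>Total degree, with value 0 at the zero polynomial.\<close>

definition xy_degree :: "xypoly \<Rightarrow> nat" where
  "xy_degree P = Max (insert 0 {i + j | i j. coeff (coeff P i) j \<noteq> 0})"

definition pmap_degree :: "pmap \<Rightarrow> nat" where
  "pmap_degree F = max (xy_degree (fst F)) (xy_degree (snd F))"

definition Aff :: "pmap set" where
  "Aff = {F \<in> GA. pmap_degree F = 1}"

definition Tri :: "pmap set" where
  "Tri = {([:P, [:a:]:], [:[:c, b:]:]) | a b c P. a \<noteq> 0 \<and> b \<noteq> 0}"

text \<open>\<open>GA_polydegree [d\<^sub>1, \<dots>, d\<^sub>k]\<close> is the set of all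
  $\alpha_0\tau_1\alpha_1\cdots\tau_k\alpha_k$, reduced, with $\deg\tau_i = d_i$.\<close>

definition GA_polydegree :: "nat list \<Rightarrow> pmap set" where
  "GA_polydegree ds =
     {foldl (\<lambda>F i. F \<odot> \<tau> i \<odot> \<alpha> i) (\<alpha> 0) [1..<Suc (length ds)] | \<tau> \<alpha>.
        (\<forall>i \<in> {0..length ds}. \<alpha> i \<in> Aff) \<and>
        (\<forall>i \<in> {1..length ds}. \<tau> i \<in> Tri - Aff) \<and>
        (\<forall>i \<in> {0<..<length ds}. \<alpha> i \<notin> Tri) \<and>
        (\<forall>i \<in> {1..length ds}. pmap_degree (\<tau> i) = ds ! (i - 1))}"

section \<open>The ind-variety topology\<close>

definition pmaps_upto :: "nat \<Rightarrow> pmap set" where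
  "pmaps_upto n = {F. pmap_degree F \<le> n}"

definition GA_upto :: "nat \<Rightarrow> pmap set" where
  "GA_upto n = {F \<in> GA. pmap_degree F \<le> n}"

text \<open>Linear coordinates on \<^const>\<open>pmaps_upto\<close>: \<open>Inl (i, j)\<close> and \<open>Inr (i, j)\<close> index the coefficient
  of $X^iY^j$ in the first and in the second component.\<close>

type_synonym coord = "(nat \<times> nat) + (nat \<times> nat)"

fun pmap_coord :: "pmap \<Rightarrow> coord \<Rightarrow> complex" where
  "pmap_coord F (Inl (i, j)) = coeff (coeff (fst F) i) j"
| "pmap_coord F (Inr (i, j)) = coeff (coeff (snd F) i) j"

definition coords_upto :: "nat \<Rightarrow> coord set" where
  "coords_upto n = {(i, j). i + j \<le> n} <+> {(i, j). i + j \<le> n}"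

definition zariski_closed :: "nat \<Rightarrow> pmap set \<Rightarrow> bool" where
  "zariski_closed n Z \<longleftrightarrow>
     (\<exists>S :: (coord, complex) mpol set. (\<forall>p \<in> S. mpol_vars p \<subseteq> coords_upto n) \<and>
        Z = {F \<in> pmaps_upto n. \<forall>p \<in> S. mpol_eval (pmap_coord F) p = 0})"

definition ind_closed :: "pmap set \<Rightarrow> bool" where
  "ind_closed C \<longleftrightarrow> C \<subseteq> GA \<and>
     (\<forall>n. \<exists>Z. zariski_closed n Z \<and> C \<inter> GA_upto n = Z \<inter> GA_upto n)"

text \<open>The closure of \<open>A\<close> is the smallest closed set \<open>ind_closed hull A\<close> containing \<open>A\<close>.\<close>

abbreviation ind_closure :: "pmap set \<Rightarrow> pmap set" where
  "ind_closure A \<equiv> ind_closed hull A"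

end

theory Submission
  imports Defs
    "Jordan_Normal_Form.Char_Poly"
    "HOL-Computational_Algebra.Fundamental_Theorem_Algebra"
    "HOL-Computational_Algebra.Polynomial_FPS"
    "HOL-Library.Countable_Set"
    "HOL-Analysis.Continuum_Not_Denumerable"
begin

text \<open>Put \<open>P\<^sub>x(u) = 1 + x\<^sub>1 u + \<dots> + x\<^sub>e u\<^sup>e\<close>. By Lagrange inversion \<open>g\<^sub>k(x)\<close> is the coefficient of
  \<open>Y\<^bsup>k+1\<^esup>\<close> in the compositional inverse of \<open>Y P\<^sub>x(Y)\<close>, and \<open>a\<^bsub>d,e\<^esub>\<close> is up to sign the Jacobian
  determinant of \<open>(g\<^sub>d, \<dots>, g\<^bsub>d+e-1\<^esub>)\<close>. The condition \<open>PIC(d,e)\<close>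
      and the Nullstellensatz give a complex
  point where \<open>g\<^sub>d, \<dots>, g\<^bsub>d+e-2\<^esub>\<close> vanish but \<open>a\<^bsub>d,e\<^esub>\<close> does not, hence \<open>g\<^bsub>d+e-1\<^esub>\<close> does not either.
  Newton iteration turns it into a polynomial curve \<open>x(z)\<close> along which \<open>g\<^sub>k(x(z))\<close> is asymptotic to
  \<open>c\<^sub>k z\<^bsup>d+e-1-k\<^esup>\<close> with prescribed \<open>c\<^sub>k\<close>. Replacing \<open>x\<^sub>i\<close> by \<open>z\<^sup>i x\<^sub>i\<close>, let \<open>f\<^sub>z
      = Y P(Y)\<close>, of degree
  \<open>e + 1\<close>, and let \<open>q\<^sub>z\<close> be a perturbation of the truncation at degree \<open>d\<close> of its inverse. Then with
  \<open>t = z\<^bsup>d+e-1\<^esup>\<close> the automorphisms \<open>((q\<^sub>z(W) - Y) / t, W)\<close>, \<open>W = f\<^sub>z(Y) + t X\<close>, have polydegree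
  \<open>(d, e + 1)\<close> and converge coefficientwise to \<open>(X
      + Q(Y), Y)\<close>, where \<open>Q\<close> is any polynomial of degree
  \<open>d + e\<close>, up to a scaling.\<close>

section \<open>The Nullstellensatz\<close>

text \<open>The polynomial g_k is isobaric of weight k, so x_i -> z^i x_i multiplies it by z^k. This
  explains the exponents d+e-1-k: after the scaling all of g_d, ..., g_(d+e-1) have order at least
  z^(d+e-1), and the later ones are smaller by weight alone. These are e conditions on e unknowns,
  with invertible Jacobian at the starting point. The last condition has exponent 0, so its constant
  is the value of g_(d+e-1) at that point and cannot be prescribed; it only has to be nonzero, and
  the final scaling absorbs it. A relative error tending to 0 is harmless, so solving modulo z^e by
  finitely many Newton steps is enough. The coefficients of Q in degrees d+1, ..., d+e come from the
  curve, those in degrees at most d from the perturbation of q. The degrees of f and q must be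
  exactly e+1 and d for small z \<noteq> 0, which costs two small corrections. PIC speaks of ideals
  over the rationals in finitely many variables, whereas the Nullstellensatz is first proved over
  the complex numbers with any countable set of variables; a rational-linear projection of the
  complex numbers onto the rationals links the two.\<close>

lemma poly_mapping_induct [case_names zero single_add]:
  fixes p :: "'k \<Rightarrow>\<^sub>0 'a::ab_group_add"
  assumes "P 0" and "\<And>p m c. P p \<Longrightarrow> P (Poly_Mapping.single m c + p)"
  shows "P p"
proof -
  have *: "P (\<Sum>m\<in>S. Poly_Mapping.single m (Poly_Mapping.lookup p m))" if "finite S" for S
    using that by induction (use assms in auto)
  have "p = (\<Sum>m\<in>Poly_Mapping.keys p. Poly_Mapping.single m (Poly_Mapping.lookup p m))"
  proof (rule poly_mapping_eqI)
    fix k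
    have "(\<Sum>m\<in>Poly_Mapping.keys p. Poly_Mapping.lookup (Poly_Mapping.single m (Poly_Mapping.lookup
        p m)) k)
      = (\<Sum>m\<in>Poly_Mapping.keys p. if m = k then Poly_Mapping.lookup p m else 0)"
      by (intro sum.cong) (auto simp: lookup_single when_def)
    then show "Poly_Mapping.lookup p k
      = Poly_Mapping.lookup (\<Sum>m\<in>Poly_Mapping.keys p. Poly_Mapping.single m (Poly_Mapping.lookup p
          m)) k"
      by (simp add: lookup_sum sum.delta in_keys_iff)
  qed
  then show ?thesis using *[of "Poly_Mapping.keys p"] by simp
qed

lemma additive_eqI:
  fixes F G :: "('k \<Rightarrow>\<^sub>0 'a::ab_group_add) \<Rightarrow> 'b::ab_group_add"
  assumes F: "\<And>p q. F (p + q) = F p + F q" and G: "\<And>p q. G (p + q) = G p + G q"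
    and "\<And>m c. F (Poly_Mapping.single m c) = G (Poly_Mapping.single m c)"
  shows "F p = G p"
proof (induction p rule: poly_mapping_induct)
  case zero
  have "F (0 + 0) = F 0 + F 0" "G (0 + 0) = G 0 + G 0" using F G by blast+
  then show ?case by simp
qed (simp add: assms)

text \<open>Product laws for maps between polynomial rings are additive in each factor, so it
  suffices to check them on pairs of monomials.\<close>

lemma biadditive_eqI:
  fixes F G :: "('k \<Rightarrow>\<^sub>0 'a::ab_group_add) \<Rightarrow> ('l \<Rightarrow>\<^sub>0 'c::ab_group_add) \<Rightarrow> 'b::ab_group_add"
  assumes "\<And>p p' q. F (p + p') q = F p q + F p' q" "\<And>p q q'. F p (q + q') = F p q + F p q'"
    and "\<And>p p' q. G (p + p') q = G p q + G p' q" "\<And>p q q'. G p (q + q') = G p q + G p q'"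
    and "\<And>m c n d. F (Poly_Mapping.single m c) (Poly_Mapping.single n d)
      = G (Poly_Mapping.single m c) (Poly_Mapping.single n d)"
  shows "F p q = G p q"
proof (rule additive_eqI[of "\<lambda>p. F p q" "\<lambda>p. G p q"])
  show "F (Poly_Mapping.single m c) q = G (Poly_Mapping.single m c) q" for m c
    by (rule additive_eqI[of "F (Poly_Mapping.single m c)" "G (Poly_Mapping.single m c)"])
      (use assms in auto)
qed (use assms in auto)

text \<open>An exponent vector is determined by its graph over its support, a finite subset of a
  countable set.\<close>

lemma countable_poly_mapping: "countable (UNIV :: ('v::countable \<Rightarrow>\<^sub>0 nat) set)"
proof -
  let ?f = "\<lambda>p :: 'v \<Rightarrow>\<^sub>0 nat. (\<lambda>k. (k, Poly_Mapping.lookup p k)) ` Poly_Mapping.keys p"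
  have "inj ?f"
  proof (rule injI, rule poly_mapping_eqI)
    fix p q k assume "?f p = ?f q"
    moreover have "r \<in> ?f s \<longleftrightarrow> snd r = Poly_Mapping.lookup s (fst r) \<and> snd r \<noteq> 0" for r s
      by (cases r) (auto simp: in_keys_iff image_iff)
    ultimately have "(snd r = Poly_Mapping.lookup p (fst r) \<and> snd r \<noteq> 0)
      \<longleftrightarrow> (snd r = Poly_Mapping.lookup q (fst r) \<and> snd r \<noteq> 0)" for r by metis
    from this[of "(k, Poly_Mapping.lookup p k)"] this[of "(k, Poly_Mapping.lookup q k)"]
    show "Poly_Mapping.lookup p k = Poly_Mapping.lookup q k" by auto
  qed
  moreover have "countable (range ?f)"
    by (rule countable_subset[OF _ countable_Collect_finite]) auto
  ultimately show ?thesis by (rule countable_image_inj_on[rotated])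
qed

text \<open>Gaussian elimination: a pivot \<open>t0\<close> with nonzero coefficient in equation k
  is solved for, which leaves one equation and one unknown fewer.\<close>

lemma underdetermined_system:
  fixes F :: "'i \<Rightarrow> 'k \<Rightarrow> 'a::field"
  assumes "finite K" "finite T" "card K < card T"
  shows "\<exists>c. (\<exists>t\<in>T. c t \<noteq> 0) \<and> (\<forall>k\<in>K. (\<Sum>t\<in>T. c t * F t k) = 0)"
  using assms
proof (induction K arbitrary: T F rule: finite_induct)
  case empty
  then obtain t where "t \<in> T" by fastforce
  then show ?case by (intro exI[of _ "\<lambda>_. 1"]) auto
next
  case (insert k K)
  show ?case
  proof (cases "\<forall>t\<in>T. F t k = 0")
    case True
    have "card K < card T" using insert by simp
    from insert.IH[OF insert.prems(1) this, of F] True show ?thesis by auto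
  next
    case False
    then obtain t0 where t0: "t0 \<in> T" "F t0 k \<noteq> 0" by blast
    let ?T = "T - {t0}" and ?F = "\<lambda>t m. F t m - F t k / F t0 k * F t0 m"
    have "finite ?T" "card K < card ?T" using insert t0 by auto
    from insert.IH[OF this, of ?F] obtain c where
      c: "\<exists>t\<in>?T. c t \<noteq> 0" "\<And>m. m \<in> K \<Longrightarrow> (\<Sum>t\<in>?T. c t * ?F t m) = 0" by blast
    let ?c = "\<lambda>t. if t = t0 then - (\<Sum>t\<in>?T. c t * (F t k / F t0 k)) else c t"
    have sum: "(\<Sum>t\<in>T. ?c t * F t m) = (\<Sum>t\<in>?T. c t * ?F t m)" for m
    proof -
      have "(\<Sum>t\<in>T. ?c t * F t m) = ?c t0 * F t0 m + (\<Sum>t\<in>?T. ?c t * F t m)"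
        using insert.prems(1) t0(1) by (rule sum.remove)
      also have "(\<Sum>t\<in>?T. ?c t * F t m) = (\<Sum>t\<in>?T. c t * F t m)"
        by (intro sum.cong) auto
      also have "?c t0 * F t0 m + (\<Sum>t\<in>?T. c t * F t m)
        = (\<Sum>t\<in>?T. c t * F t m) - (\<Sum>t\<in>?T. c t * (F t k / F t0 k)) * F t0 m"
        by simp
      also have "\<dots> = (\<Sum>t\<in>?T. c t * ?F t m)"
        unfolding sum_distrib_right sum_subtractf[symmetric]
        by (intro sum.cong refl) (simp add: algebra_simps)
      finally show ?thesis .
    qed
    have "(\<Sum>t\<in>?T. c t * ?F t k) = 0" using t0 by simp
    with sum c show ?thesis by (intro exI[of _ ?c]) auto
  qed
qed

section \<open>Prime ideals and points over the complex numbers\<close>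

text \<open>Ideals of the whole type, free of carriers; the passage to ideals of
  \<open>mpol_ring V\<close> is made in \<open>rational_nullstellensatz\<close>.\<close>

definition ring_ideal :: "'a::comm_ring_1 set \<Rightarrow> bool" where
  "ring_ideal I \<longleftrightarrow> 0 \<in> I \<and> (\<forall>x\<in>I. \<forall>y\<in>I. x + y \<in> I) \<and> (\<forall>x. \<forall>y\<in>I. x * y \<in> I)"

lemma
  assumes "ring_ideal I"
  shows ring_ideal_zero: "0 \<in> I" and ring_ideal_add: "x \<in> I \<Longrightarrow> y \<in> I \<Longrightarrow> x + y \<in> I"
    and ring_ideal_mult: "y \<in> I \<Longrightarrow> x * y \<in> I" and ring_ideal_mult2: "y \<in> I \<Longrightarrow> y * x \<in> I"
    and ring_ideal_diff: "x \<in> I \<Longrightarrow> y \<in> I \<Longrightarrow> x - y \<in> I"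
proof -
  have add: "x \<in> I \<Longrightarrow> y \<in> I \<Longrightarrow> x + y \<in> I" and mult: "y \<in> I \<Longrightarrow> x * y \<in> I" for x y
    using assms by (auto simp: ring_ideal_def)
  then show "x \<in> I \<Longrightarrow> y \<in> I \<Longrightarrow> x + y \<in> I" and "y \<in> I \<Longrightarrow> x * y \<in> I" by blast+
  show "0 \<in> I" using assms by (auto simp: ring_ideal_def)
  show "y \<in> I \<Longrightarrow> y * x \<in> I" using mult[of y x] by (simp add: mult.commute)
  show "x \<in> I \<Longrightarrow> y \<in> I \<Longrightarrow> x - y \<in> I" using add[of x "-1 * y"] mult[of y "-1"] by simp
qed

lemma ring_ideal_sum:
  assumes "ring_ideal I" "\<And>i. i \<in> A \<Longrightarrow> f i \<in> I"
  shows "sum f A \<in> I"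
  using assms(2) by (induction A rule: infinite_finite_induct)
    (auto intro: ring_ideal_add ring_ideal_zero assms(1))

text \<open>Zorn's lemma gives an ideal that is maximal among those avoiding the powers of a; such
  an ideal is prime. Its quotient becomes a field once a is inverted, which is the fourth
  conclusion. This localization takes the place of an extra variable inverse to a.\<close>

lemma exists_prime_ideal_avoiding:
  fixes J :: "'a::comm_ring_1 set"
  assumes J: "ring_ideal J" and a: "\<And>n. a ^ n \<notin> J"
  obtains M where "ring_ideal M" "J \<subseteq> M" "\<And>n. a ^ n \<notin> M"
    "\<And>x. x \<notin> M \<Longrightarrow> \<exists>h n. x * h - a ^ n \<in> M"
    "\<And>x y. x * y \<in> M \<Longrightarrow> x \<in> M \<or> y \<in> M"
proof -
  let ?A = "{M. ring_ideal M \<and> J \<subseteq> M \<and> (\<forall>n. a ^ n \<notin> M)}"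
  have "\<exists>M\<in>?A. \<forall>X\<in>?A. M \<subseteq> X \<longrightarrow> X = M"
  proof (rule subset_Zorn_nonempty)
    show "?A \<noteq> {}" using assms by auto
  next
    fix C assume C: "C \<noteq> {}" "subset.chain ?A C"
    then have CA: "C \<subseteq> ?A" and lin: "\<And>X Y. X \<in> C \<Longrightarrow> Y \<in> C \<Longrightarrow> X \<subseteq> Y \<or> Y \<subseteq> X"
      by (auto simp: subset_chain_def)
    have "x + y \<in> \<Union>C" if "x \<in> \<Union>C" "y \<in> \<Union>C" for x y
    proof -
      from that obtain X Y where XY: "X \<in> C" "Y \<in> C" "x \<in> X" "y \<in> Y" by blast
      then have "ring_ideal X" "ring_ideal Y" using CA by auto
      with XY lin[OF XY(1,2)] show ?thesis by (meson UnionI ring_ideal_add subsetD)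
    qed
    moreover have "0 \<in> \<Union>C" using C(1) CA ring_ideal_zero by fastforce
    moreover have "x * y \<in> \<Union>C" if "y \<in> \<Union>C" for x y
      using that CA by (auto intro: ring_ideal_mult)
    ultimately have "ring_ideal (\<Union>C)" by (simp add: ring_ideal_def)
    with C(1) CA show "\<Union>C \<in> ?A" by fast
  qed
  then obtain M where MA: "M \<in> ?A" and max': "\<forall>X\<in>?A. M \<subseteq> X \<longrightarrow> X = M" by (rule bexE)
  from MA have M: "ring_ideal M" "J \<subseteq> M" "\<And>n. a ^ n \<notin> M" by simp_all
  have max: "X = M" if "ring_ideal X" "J \<subseteq> X" "\<And>n. a ^ n \<notin> X" "M \<subseteq> X" for X
    using max' that by simp
  have *: "\<exists>h n. x * h - a ^ n \<in> M" if x: "x \<notin> M" for x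
  proof (rule ccontr)
    assume neg: "\<not> ?thesis"
    \<comment> \<open>The ideal generated by M and x. Under \<open>neg\<close> it contains no power
      of a, so maximality forces it back to M.\<close>
    let ?X = "{m + x * h | m h. m \<in> M}"
    have id: "ring_ideal ?X"
      unfolding ring_ideal_def
    proof (intro conjI ballI allI)
      show "0 \<in> ?X" using ring_ideal_zero[OF M(1)] by (intro CollectI exI[of _ 0]) auto
    next
      fix p q assume "p \<in> ?X" "q \<in> ?X"
      then obtain m h m' h' where "p = m + x * h" "q = m' + x * h'" "m \<in> M" "m' \<in> M" by blast
      then show "p + q \<in> ?X" using ring_ideal_add[OF M(1)]
        by (intro CollectI exI[of _ "m + m'"] exI[of _ "h + h'"]) (auto simp: algebra_simps)
    next
      fix p q assume "q \<in> ?X"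
      then obtain m h where "q = m + x * h" "m \<in> M" by blast
      then show "p * q \<in> ?X" using ring_ideal_mult[OF M(1)]
        by (intro CollectI exI[of _ "p * m"] exI[of _ "p * h"]) (auto simp: algebra_simps)
    qed
    have MX: "M \<subseteq> ?X"
    proof
      fix m assume "m \<in> M"
      then show "m \<in> ?X" by (intro CollectI exI[of _ m] exI[of _ 0]) simp
    qed
    have "a ^ n \<notin> ?X" for n
    proof
      assume "a ^ n \<in> ?X"
      then obtain m h where mh: "a ^ n = m + x * h" "m \<in> M" by blast
      then have "x * h - a ^ n = 0 - m" by simp
      with mh(2) neg show False by (metis M(1) ring_ideal_diff ring_ideal_zero)
    qed
    from max[OF id _ this MX] M(2) MX have "?X = M" by (meson subset_trans)
    moreover have "x \<in> ?X" using ring_ideal_zero[OF M(1)]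
      by (intro CollectI exI[of _ 0] exI[of _ 1]) auto
    ultimately show False using x by blast
  qed
  moreover have "x \<in> M \<or> y \<in> M" if xy: "x * y \<in> M" for x y
  proof (rule ccontr)
    assume "\<not> ?thesis"
    with * obtain h n h' n' where h: "x * h - a ^ n \<in> M" "y * h' - a ^ n' \<in> M" by metis
    \<comment> \<open>Modulo M the two powers of a are x h and y h', so their product is a multiple
      of x y.\<close>
    have "a ^ (n + n') = h * h' * (x * y) - (x * h - a ^ n) * (y * h') - a ^ n * (y * h' - a ^ n')"
      by (simp add: algebra_simps power_add)
    also have "\<dots> \<in> M"
      by (intro ring_ideal_diff[OF M(1)] ring_ideal_mult[OF M(1), OF xy]
          ring_ideal_mult[OF M(1), OF h(2)] ring_ideal_mult2[OF M(1), OF h(1)])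
    finally show False using M(3) by blast
  qed
  ultimately show ?thesis using that M by blast
qed

abbreviation mConst :: "'a \<Rightarrow> ('v, 'a::comm_ring_1) mpol" where
  "mConst c \<equiv> Poly_Mapping.single 0 c"

abbreviation mVar :: "'v \<Rightarrow> ('v, 'a::comm_ring_1) mpol" where
  "mVar v \<equiv> Poly_Mapping.single (Poly_Mapping.single v 1) 1"

lemma comm_ring_hom_mConst: "comm_ring_hom (mConst :: 'a \<Rightarrow> ('v, 'a::comm_ring_1) mpol)"
  by unfold_locales (simp_all add: single_add mult_single)

text \<open>Over the complex numbers r splits into linear factors, and primality puts one of the
  factors X - c into M; the leading constant is a unit and cannot lie in M.\<close>

lemma prime_ideal_root:
  fixes M :: "('v, complex) mpol set" and r :: "complex poly"
  assumes M: "ring_ideal M" "1 \<notin> M" and prime: "\<And>x y. x * y \<in> M \<Longrightarrow> x \<in> M \<or> y \<in> M"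
    and "r \<noteq> 0" and "poly (map_poly mConst r) X \<in> M"
  shows "\<exists>c. X - mConst c \<in> M"
  using assms(4,5)
proof (induction "degree r" arbitrary: r)
  interpret comm_ring_hom "mConst :: complex \<Rightarrow> ('v, complex) mpol" by (rule comm_ring_hom_mConst)
  interpret P: map_poly_comm_ring_hom "mConst :: complex \<Rightarrow> ('v, complex) mpol" ..
  {
    case 0
    then obtain c where c: "r = [:c:]" "c \<noteq> 0" by (metis degree_eq_zeroE pCons_0_0)
    with 0 have "mConst c \<in> M" by simp
    then have "mConst (inverse c) * mConst c \<in> M" by (rule ring_ideal_mult[OF M(1)])
    with c M(2) show ?case by (simp add: mult_single)
  next
    case (Suc n)
    then have "\<not> constant (poly r)" by (simp add: constant_degree)
    then obtain c where "poly r c = 0" using fundamental_theorem_of_algebra by blast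
    then obtain s where s: "r = [:-c, 1:] * s" by (metis dvdE poly_eq_0_iff_dvd)
    with Suc.prems(1) have "s \<noteq> 0" by auto
    then have "degree r = Suc (degree s)" unfolding s by (subst degree_mult_eq) auto
    with Suc.hyps(2) have "degree s = n" by simp
    have "poly (map_poly mConst r) X = (X - mConst c) * poly (map_poly mConst s) X"
      unfolding s P.hom_mult poly_mult by (simp add: single_uminus)
    with Suc.prems prime have "X - mConst c \<in> M \<or> poly (map_poly mConst s) X \<in> M" by metis
    with Suc.hyps(1)[of s] \<open>s \<noteq> 0\<close> \<open>degree s = n\<close> show ?case by blast
  }
qed

text \<open>Since \<open>\<complex>\<close> is uncountable while polynomials have countably many monomials, the inverses
  of \<open>X - c\<close> modulo \<open>M\<close>, \<open>c\<close> ranging over \<open>\<complex>\<close>, satisfy a linear relation. Clearing denominators in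
  it yields a univariate polynomial which \<open>X\<close> satisfies modulo \<open>M\<close>.\<close>

lemma prime_ideal_constant:
  fixes M :: "('v::countable, complex) mpol set"
  assumes M: "ring_ideal M" "\<And>n. a ^ n \<notin> M"
    and max: "\<And>x. x \<notin> M \<Longrightarrow> \<exists>h n. x * h - a ^ n \<in> M"
    and prime: "\<And>x y. x * y \<in> M \<Longrightarrow> x \<in> M \<or> y \<in> M"
  shows "\<exists>c. X - mConst c \<in> M"
proof (rule ccontr)
  interpret comm_ring_hom "mConst :: complex \<Rightarrow> ('v, complex) mpol" by (rule comm_ring_hom_mConst)
  interpret P: map_poly_comm_ring_hom "mConst :: complex \<Rightarrow> ('v, complex) mpol" ..
  assume neg: "\<not> ?thesis"
  then have "\<exists>h n. (X - mConst c) * h - a ^ n \<in> M" for c using max by blast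
  then obtain h n where h: "\<And>c. (X - mConst c) * h c - a ^ n c \<in> M" by metis
  let ?e = "to_nat_on (UNIV :: ('v \<Rightarrow>\<^sub>0 nat) set)"
  have inj: "inj ?e" by (rule inj_on_to_nat_on[OF countable_poly_mapping])
  have "\<exists>N. \<forall>m\<in>Poly_Mapping.keys (h c). ?e m < N" for c
    by (metis finite_imageI finite_keys finite_nat_set_iff_bounded image_eqI)
  then obtain N where N: "\<And>c m. m \<in> Poly_Mapping.keys (h c) \<Longrightarrow> ?e m < N c" by metis
  \<comment> \<open>There are only countably many pairs \<open>(n c, N c)\<close>, so infinitely
    many c share one pair (k, K). Their h c use a common power of a and lie in the span of at most K
    monomials, so any K + 1 of them are linearly dependent.\<close>
  have "uncountable (UNIV :: complex set)"
    using uncountable_UNIV_complex by blast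
  moreover have "countable (UNIV :: complex set)" if "\<And>r. countable {c. (n c, N c) = r}"
  proof -
    have "countable (\<Union>r. {c. (n c, N c) = r})" using that by (intro countable_UN) auto
    also have "(\<Union>r. {c. (n c, N c) = r}) = UNIV" by auto
    finally show ?thesis .
  qed
  ultimately obtain r where "uncountable {c. (n c, N c) = r}" by blast
  then obtain k K where "uncountable {c. (n c, N c) = (k, K)}" by (cases r) auto
  then have "infinite {c. (n c, N c) = (k, K)}" using countable_finite by blast
  then obtain T where T: "T \<subseteq> {c. (n c, N c) = (k, K)}" "finite T" "card T = Suc K"
    using infinite_arbitrarily_large by blast
  let ?K = "{m. ?e m < K}"
  have finK: "finite ?K" using finite_vimageI[OF _ inj, of "{..<K}"] by (simp add: vimage_def)
  have "card ?K \<le> card {..<K}"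
    by (rule card_inj_on_le[of ?e]) (use inj in \<open>auto intro: inj_on_subset\<close>)
  with T have "card ?K < card T" by simp
  from underdetermined_system[OF finK T(2) this, of "\<lambda>c m. Poly_Mapping.lookup (h c) m"]
  obtain u t0 where t0: "t0 \<in> T" "u t0 \<noteq> 0"
    and u: "\<And>m. m \<in> ?K \<Longrightarrow> (\<Sum>t\<in>T. u t * Poly_Mapping.lookup (h t) m) = 0" by blast
  have *: "Poly_Mapping.lookup (mConst c * p) m = c * Poly_Mapping.lookup p m" for c m
    and p :: "('v, complex) mpol"
    by (simp add: mult_map_scale_conv_mult[symmetric] map.rep_eq when_def)
  have rel: "(\<Sum>t\<in>T. mConst (u t) * h t) = 0"
  proof (rule poly_mapping_eqI)
    fix m
    have "(\<Sum>t\<in>T. u t * Poly_Mapping.lookup (h t) m) = 0"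
    proof (cases "m \<in> ?K")
      case False
      then have "Poly_Mapping.lookup (h t) m = 0" if "t \<in> T" for t
        using N[of m t] that T(1) by (auto simp: in_keys_iff)
      then show ?thesis by simp
    qed (rule u)
    then show "Poly_Mapping.lookup (\<Sum>t\<in>T. mConst (u t) * h t) m = Poly_Mapping.lookup 0 m"
      by (simp add: lookup_sum *)
  qed
  \<comment> \<open>The numerator of the sum of the fractions u t / (x - t). Modulo M each h t
    behaves like a^k / (X - t), so the linear relation between the h t says that a^k r(X) lies in M,
    and primality removes a^k. At \<open>t0\<close> only one summand of r survives, so r is not
    zero.\<close>
  define r where "r = (\<Sum>t\<in>T. [:u t:] * (\<Prod>s\<in>T - {t}. [:-s, 1:]))"
  define Q where "Q t = (\<Prod>s\<in>T - {t}. X - mConst s)" for t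
  have rX: "poly (map_poly mConst r) X = (\<Sum>t\<in>T. mConst (u t) * Q t)"
    unfolding r_def Q_def by (simp add: P.hom_sum P.hom_prod P.hom_mult poly_sum poly_prod
        single_uminus map_poly_pCons_hom
        del: mult_pCons_left)
  have "a ^ k * (\<Sum>t\<in>T. mConst (u t) * Q t)
    = (\<Sum>t\<in>T. (X - mConst t) * Q t * (mConst (u t) * h t))
      - (\<Sum>t\<in>T. mConst (u t) * Q t * ((X - mConst t) * h t - a ^ k))"
    by (simp add: sum_subtractf[symmetric] sum_distrib_left algebra_simps)
  also have "(\<Sum>t\<in>T. (X - mConst t) * Q t * (mConst (u t) * h t))
    = (\<Sum>t\<in>T. (\<Prod>s\<in>T. X - mConst s) * (mConst (u t) * h t))"
    using T(2) by (intro sum.cong refl) (simp add: Q_def prod.remove)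
  also have "\<dots> = 0" by (simp add: sum_distrib_left[symmetric] rel)
  also have "0 - (\<Sum>t\<in>T. mConst (u t) * Q t * ((X - mConst t) * h t - a ^ k)) \<in> M"
  proof (rule ring_ideal_diff[OF M(1) ring_ideal_zero[OF M(1)] ring_ideal_sum[OF M(1)]])
    fix t assume "t \<in> T"
    then have "n t = k" using T(1) by auto
    then show "mConst (u t) * Q t * ((X - mConst t) * h t - a ^ k) \<in> M"
      using h[of t] by (intro ring_ideal_mult[OF M(1)]) simp
  qed
  finally have "(\<Sum>t\<in>T. mConst (u t) * Q t) \<in> M" using prime M(2) by blast
  moreover have "poly r t0 = u t0 * (\<Prod>s\<in>T - {t0}. t0 - s)"
  proof -
    have "poly r t0 = (\<Sum>t\<in>T. u t * (\<Prod>s\<in>T - {t}. t0 - s))"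
      by (simp add: r_def poly_sum poly_prod)
    also have "\<dots> = u t0 * (\<Prod>s\<in>T - {t0}. t0 - s)
        + (\<Sum>t\<in>T - {t0}. u t * (\<Prod>s\<in>T - {t}. t0 - s))"
      using T(2) t0(1) by (rule sum.remove)
    also have "(\<Sum>t\<in>T - {t0}. u t * (\<Prod>s\<in>T - {t}. t0 - s)) = 0"
      using t0(1) T(2) by (intro sum.neutral) auto
    finally show ?thesis by simp
  qed
  then have "r \<noteq> 0" using t0(2) T(2) by auto
  moreover have "1 \<notin> M" using M(2)[of 0] by simp
  ultimately show False using prime_ideal_root[OF M(1) _ prime] rX neg by metis
qed

text \<open>Modulo the prime ideal M every polynomial is congruent to exactly one constant; mapping
  it to this constant is evaluation at the desired point.\<close>

theorem complex_nullstellensatz: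
  fixes J :: "('v::countable, complex) mpol set"
  assumes J: "ring_ideal J" and a: "\<And>n. a ^ n \<notin> J"
  obtains \<chi> :: "('v, complex) mpol \<Rightarrow> complex"
    where "comm_ring_hom \<chi>" "\<And>c. \<chi> (mConst c) = c" "\<And>p. p \<in> J \<Longrightarrow> \<chi> p = 0" "\<chi> a \<noteq> 0"
proof -
  obtain M where M: "ring_ideal M" "J \<subseteq> M" "\<And>n. a ^ n \<notin> M"
    and max: "\<And>x. x \<notin> M \<Longrightarrow> \<exists>h n. x * h - a ^ n \<in> M"
    and prime: "\<And>x y. x * y \<in> M \<Longrightarrow> x \<in> M \<or> y \<in> M"
    using exists_prime_ideal_avoiding[OF assms] by metis
  have ex: "\<exists>c. p - mConst c \<in> M" for p
    by (rule prime_ideal_constant[OF M(1,3) max prime])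
  have uniq: "c = c'" if "p - mConst c \<in> M" "p - mConst c' \<in> M" for p c c'
  proof (rule ccontr)
    assume "c \<noteq> c'"
    have "mConst (inverse (c' - c)) * ((p - mConst c) - (p - mConst c')) \<in> M"
      by (intro ring_ideal_mult ring_ideal_diff M that)
    also have "(p - mConst c) - (p - mConst c') = mConst (c' - c)"
      by (simp add: single_diff)
    finally show False using \<open>c \<noteq> c'\<close> M(3)[of 0] by (simp add: mult_single)
  qed
  define \<chi> where "\<chi> p = (THE c. p - mConst c \<in> M)" for p
  have \<chi>: "p - mConst (\<chi> p) \<in> M" for p
    unfolding \<chi>_def using ex[of p] by (auto intro: theI' uniq)
  have \<chi>_eq: "\<chi> p = c" if "p - mConst c \<in> M" for p c using uniq \<chi> that by blast
  have const: "\<chi> (mConst c) = c" for c by (rule \<chi>_eq) (simp add: ring_ideal_zero M)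
  have "comm_ring_hom \<chi>"
  proof
    fix p q
    have "(p - mConst (\<chi> p)) + (q - mConst (\<chi> q)) \<in> M" by (intro ring_ideal_add M \<chi>)
    then show "\<chi> (p + q) = \<chi> p + \<chi> q" by (intro \<chi>_eq) (simp add: single_add algebra_simps)
    have "q * (p - mConst (\<chi> p)) + mConst (\<chi> p) * (q - mConst (\<chi> q)) \<in> M"
      by (intro ring_ideal_add ring_ideal_mult M \<chi>)
    then show "\<chi> (p * q) = \<chi> p * \<chi> q" by (intro \<chi>_eq) (simp add: mult_single algebra_simps)
  qed (use const[of 0] const[of 1] in auto)
  moreover have "\<chi> p = 0" if "p \<in> J" for p using that M(2) by (intro \<chi>_eq) auto
  moreover have "\<chi> a \<noteq> 0" using \<chi>[of a] M(3)[of 1] by auto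
  ultimately show ?thesis using that const by blast
qed

section \<open>Descent from complex to rational coefficients\<close>

text \<open>Extend 1 to a rational basis of the complex numbers. Applied to coefficients, the
  projection turns complex cofactors of rational generators into rational ones.\<close>

lemma exists_rational_projection:
  obtains \<phi> :: "complex \<Rightarrow> rat"
  where "\<And>x y. \<phi> (x + y) = \<phi> x + \<phi> y" "\<And>q x. \<phi> (of_rat q * x) = q * \<phi> x" "\<phi> 1 = 1"
proof -
  interpret V: vector_space_pair "\<lambda>q (x::complex). of_rat q * x" "(*) :: rat \<Rightarrow> rat \<Rightarrow> rat"
    by unfold_locales (simp_all add: algebra_simps of_rat_add of_rat_mult)
  have "V.vs1.independent {1}" by simp
  from V.linear_independent_extend[OF this, of "\<lambda>_. 1"] obtain \<phi>
    where \<phi>: "Vector_Spaces.linear (\<lambda>q (x::complex). of_rat q * x) ((*) :: rat \<Rightarrow> rat \<Rightarrow> rat) \<phi>"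
      "\<phi> 1 = 1" by auto
  show ?thesis
    using that[of \<phi>] V.linear_add[OF \<phi>(1)] V.linear_scale[OF \<phi>(1)] \<phi>(2) by simp
qed

lemma mpol_vars_single: "mpol_vars (Poly_Mapping.single a c) \<subseteq> Poly_Mapping.keys a"
  by (auto simp: mpol_vars_def)

lemma mpol_vars_sum: "(\<And>i. i \<in> A \<Longrightarrow> mpol_vars (f i) \<subseteq> V) \<Longrightarrow> mpol_vars (sum f A) \<subseteq> V"
proof (induction A rule: infinite_finite_induct)
  case (insert x F)
  then show ?case using mpol_vars_add[of "f x" "sum f F"] by auto
qed (auto simp: mpol_vars_def)

lemma mpol_vars_prod:
  "(\<And>i. i \<in> A \<Longrightarrow> mpol_vars (f i) \<subseteq> V) \<Longrightarrow> mpol_vars (\<Prod>i\<in>A. f i :: ('v, 'a::comm_ring_1) mpol) \<subseteq> V"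
proof (induction A rule: infinite_finite_induct)
  case (insert x F)
  then show ?case using mpol_vars_mult[of "f x" "prod f F"] by auto
qed (auto simp: mpol_vars_def)

lemma mpol_ring_nat_pow: "x [^]\<^bsub>mpol_ring V\<^esub> (n::nat) = x ^ n"
  by (induction n) (simp_all add: mpol_ring_def nat_pow_def mult.commute)

lemma genideal_mpol_ringI:
  fixes G :: "'i \<Rightarrow> ('v, 'a::comm_ring_1) mpol"
  assumes G: "\<And>k. k \<in> D \<Longrightarrow> mpol_vars (G k) \<subseteq> V" and H: "\<And>k. k \<in> D \<Longrightarrow> mpol_vars (H k) \<subseteq> V"
  shows "(\<Sum>k\<in>D. H k * G k) \<in> Idl\<^bsub>mpol_ring V\<^esub> (G ` D)"
proof -
  interpret R: cring "mpol_ring V :: ('v, 'a) mpol ring" by (rule cring_mpol_ring)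
  have sub: "G ` D \<subseteq> carrier (mpol_ring V)" using G by (auto simp: mpol_ring_def)
  interpret I: ideal "Idl\<^bsub>mpol_ring V\<^esub> (G ` D)" "mpol_ring V" by (rule R.genideal_ideal[OF sub])
  have "F \<subseteq> D \<Longrightarrow> (\<Sum>k\<in>F. H k * G k) \<in> Idl\<^bsub>mpol_ring V\<^esub> (G ` D)" for F
  proof (induction F rule: infinite_finite_induct)
    case (insert k F)
    then have k: "k \<in> D" by simp
    have "G k \<in> Idl\<^bsub>mpol_ring V\<^esub> (G ` D)" using R.genideal_self[OF sub] k by auto
    moreover have "H k \<in> carrier (mpol_ring V)" using H[OF k] by (simp add: mpol_ring_def)
    ultimately have "H k * G k \<in> Idl\<^bsub>mpol_ring V\<^esub> (G ` D)"
      using I.I_l_closed[of "G k" "H k"] by (simp add: mpol_ring_def)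
    moreover have "(\<Sum>k\<in>F. H k * G k) \<in> Idl\<^bsub>mpol_ring V\<^esub> (G ` D)" using insert by simp
    ultimately show ?case
      using I.a_closed[of "H k * G k" "\<Sum>k\<in>F. H k * G k"] insert by (simp add: mpol_ring_def)
  qed (use I.zero_closed in \<open>auto simp: mpol_ring_def\<close>)
  then show ?thesis by simp
qed

definition mpol_of_rat :: "('v, rat) mpol \<Rightarrow> ('v, complex) mpol" where
  "mpol_of_rat = Poly_Mapping.map of_rat"

lemma lookup_mpol_of_rat: "Poly_Mapping.lookup (mpol_of_rat p) m = of_rat (Poly_Mapping.lookup p m)"
  by (simp add: mpol_of_rat_def map.rep_eq when_def)

lemma mpol_of_rat_single: "mpol_of_rat (Poly_Mapping.single m c) = Poly_Mapping.single m (of_rat c)"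
  by (rule poly_mapping_eqI) (simp add: lookup_mpol_of_rat lookup_single when_def)

lemma comm_ring_hom_mpol_of_rat: "comm_ring_hom (mpol_of_rat :: ('v, rat) mpol \<Rightarrow> _)"
proof
  have add: "mpol_of_rat (p + q) = mpol_of_rat p + mpol_of_rat q" for p q :: "('v, rat) mpol"
    by (rule poly_mapping_eqI) (simp add: lookup_mpol_of_rat lookup_add of_rat_add)
  then show "mpol_of_rat (p + q) = mpol_of_rat p + mpol_of_rat q" for p q :: "('v, rat) mpol" .
  show "mpol_of_rat (p * q) = mpol_of_rat p * mpol_of_rat q" for p q :: "('v, rat) mpol"
    by (rule biadditive_eqI[of "\<lambda>p q. mpol_of_rat (p * q)" "\<lambda>p q. mpol_of_rat p * mpol_of_rat q"])
      (simp_all add: add algebra_simps mult_single mpol_of_rat_single of_rat_mult)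
  show "mpol_of_rat (1 :: ('v, rat) mpol) = 1" "mpol_of_rat (0 :: ('v, rat) mpol) = 0"
    by (auto intro!: poly_mapping_eqI simp: lookup_mpol_of_rat lookup_one when_def)
qed

text \<open>Dropping the monomials that leave V brings cofactors into the carrier of
  \<open>mpol_ring V\<close>. The test \<open>p m \<noteq> 0\<close> keeps the support finite for an
  arbitrary \<phi>.\<close>

lift_definition mpol_project :: "'v set \<Rightarrow> ('a \<Rightarrow> 'b) \<Rightarrow> ('v, 'a::zero) mpol \<Rightarrow> ('v, 'b::zero) mpol"
  is "\<lambda>V \<phi> p m. if Poly_Mapping.keys m \<subseteq> V \<and> p m \<noteq> 0 then \<phi> (p m) else 0"
  by (rule finite_subset[rotated]) auto

text \<open>If a power of a were a complex combination of the generators, the projection \<psi>,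
  which is linear over the rational polynomials in V, would turn it into a rational combination in
  the variables V, against \<open>notin\<close>. So the complex Nullstellensatz applies to the ideal
  J.\<close>

theorem rational_nullstellensatz:
  fixes G :: "'i \<Rightarrow> ('v::countable, rat) mpol"
  assumes "finite D" and G: "\<And>k. k \<in> D \<Longrightarrow> mpol_vars (G k) \<subseteq> V" and a: "mpol_vars a \<subseteq> V"
    and notin: "a \<notin> rad (mpol_ring V) (G ` D)"
  obtains \<chi> :: "('v, rat) mpol \<Rightarrow> complex"
    where "comm_ring_hom \<chi>" "\<And>q. \<chi> (mConst q) = of_rat q" "\<And>k. k \<in> D \<Longrightarrow> \<chi> (G k) = 0" "\<chi> a \<noteq> 0"
proof -
  interpret E: comm_ring_hom "mpol_of_rat :: ('v, rat) mpol \<Rightarrow> _" by (rule comm_ring_hom_mpol_of_rat)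
  define J where "J = {\<Sum>k\<in>D. H k * mpol_of_rat (G k) | H. True}"
  have J: "ring_ideal J"
    unfolding ring_ideal_def
  proof (intro conjI ballI allI)
    show "0 \<in> J" unfolding J_def by (intro CollectI exI[of _ "\<lambda>_. 0"]) simp
  next
    fix x y assume "x \<in> J" "y \<in> J"
    then obtain H H' where "x = (\<Sum>k\<in>D. H k * mpol_of_rat (G k))" "y
        = (\<Sum>k\<in>D. H' k * mpol_of_rat (G k))"
      unfolding J_def by blast
    then show "x + y \<in> J" unfolding J_def
      by (intro CollectI exI[of _ "\<lambda>k. H k + H' k"]) (simp add: sum.distrib algebra_simps)
  next
    fix x y assume "y \<in> J"
    then obtain H where "y = (\<Sum>k\<in>D. H k * mpol_of_rat (G k))" unfolding J_def by blast
    then show "x * y \<in> J" unfolding J_def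
      by (intro CollectI exI[of _ "\<lambda>k. x * H k"]) (simp add: sum_distrib_left algebra_simps)
  qed
  obtain \<phi> :: "complex \<Rightarrow> rat" where \<phi>: "\<And>x y. \<phi> (x + y) = \<phi> x + \<phi> y"
    "\<And>q x. \<phi> (of_rat q * x) = q * \<phi> x" "\<phi> 1 = 1" by (rule exists_rational_projection) blast
  have \<phi>0: "\<phi> 0 = 0" using \<phi>(2)[of 0] by simp
  define \<psi> :: "('v, complex) mpol \<Rightarrow> ('v, rat) mpol" where "\<psi> = mpol_project V \<phi>"
  have lookup: "Poly_Mapping.lookup (\<psi> p) m =
      (if Poly_Mapping.keys m \<subseteq> V then \<phi> (Poly_Mapping.lookup p m) else 0)" for p m
    by (simp add: \<psi>_def mpol_project.rep_eq \<phi>0)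
  have add: "\<psi> (p + q) = \<psi> p + \<psi> q" for p q
    by (rule poly_mapping_eqI) (simp add: lookup lookup_add \<phi>(1))
  have single: "\<psi> (Poly_Mapping.single m c) = (if Poly_Mapping.keys m
      \<subseteq> V then Poly_Mapping.single m (\<phi> c) else 0)" for m c
    by (rule poly_mapping_eqI) (auto simp: lookup lookup_single when_def \<phi>0)
  have zero: "\<psi> 0 = 0" using single[of 0 0] by (simp add: \<phi>0)
  have sum: "\<psi> (sum f A) = (\<Sum>i\<in>A. \<psi> (f i))" for f :: "'i \<Rightarrow> _" and A
    by (induction A rule: infinite_finite_induct) (auto simp: zero add)
  have vars: "mpol_vars (\<psi> p) \<subseteq> V" for p
    by (simp add: mpol_vars_def UN_subset_iff Ball_def in_keys_iff[of _ "\<psi> p"] lookup)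
  \<comment> \<open>\<rho> is the identity on polynomials in V. Inserting it makes the linearity of
    \<psi> an identity for all polynomials q, so that it can be checked on monomials.\<close>
  define \<rho> :: "('v, rat) mpol \<Rightarrow> ('v, rat) mpol" where "\<rho> = mpol_project V (\<lambda>x. x)"
  have rlookup: "Poly_Mapping.lookup (\<rho> p) m =
      (if Poly_Mapping.keys m \<subseteq> V then Poly_Mapping.lookup p m else 0)" for p m
    by (simp add: \<rho>_def mpol_project.rep_eq)
  have radd: "\<rho> (p + q) = \<rho> p + \<rho> q" for p q
    by (rule poly_mapping_eqI) (simp add: rlookup lookup_add)
  have rsingle: "\<rho> (Poly_Mapping.single m c) = (if Poly_Mapping.keys m
      \<subseteq> V then Poly_Mapping.single m c else 0)" for m c
    by (rule poly_mapping_eqI) (auto simp: rlookup lookup_single when_def)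
  have rid: "\<rho> p = p" if "mpol_vars p \<subseteq> V" for p
    using that by (intro poly_mapping_eqI) (force simp: rlookup mpol_vars_def in_keys_iff)
  have keys_plus: "Poly_Mapping.keys (m + n) = Poly_Mapping.keys m \<union> Poly_Mapping.keys n"
      for m n :: "'v \<Rightarrow>\<^sub>0 nat"
    by (auto simp: in_keys_iff lookup_add)
  have mult: "\<psi> (p * mpol_of_rat (\<rho> q)) = \<psi> p * \<rho> q" for p q
    by (rule biadditive_eqI[of "\<lambda>p q. \<psi> (p * mpol_of_rat (\<rho> q))" "\<lambda>p q. \<psi> p * \<rho> q"])
      (auto simp: add radd distrib_left distrib_right E.hom_add rsingle single mpol_of_rat_single
        mult_single keys_plus mult.commute[of _ "of_rat _"] mult.commute[of _ "\<phi> _"] \<phi>(2) zero)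
  have \<psi>1: "\<psi> 1 = 1" using single[of 0 1] by (simp add: \<phi>)
  have retract: "\<psi> (p * mpol_of_rat q) = \<psi> p * q" if "mpol_vars q \<subseteq> V" for p q
    using mult[of p q] rid[OF that] by simp
  have "mpol_of_rat a ^ n \<notin> J" for n
  proof
    assume "mpol_of_rat a ^ n \<in> J"
    then obtain H where H: "mpol_of_rat a ^ n = (\<Sum>k\<in>D. H k * mpol_of_rat (G k))"
      unfolding J_def by blast
    have "mpol_vars (a ^ m) \<subseteq> V" for m using mpol_vars_prod[of "{..<m}" "\<lambda>_. a" V] a by simp
    \<comment> \<open>\<open>rad\<close> asks for a positive exponent, hence
      \<open>Suc n\<close>.\<close>
    from retract[OF this, of 1 "Suc n"] have "a ^ Suc n = \<psi> (mpol_of_rat (a ^ Suc n))"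
      by (simp add: \<psi>1)
    also have "mpol_of_rat (a ^ Suc n) = (\<Sum>k\<in>D. (H k * mpol_of_rat a) * mpol_of_rat (G k))"
      using H by (simp add: E.hom_power E.hom_mult sum_distrib_left algebra_simps)
    also have "\<psi> \<dots> = (\<Sum>k\<in>D. \<psi> (H k * mpol_of_rat a) * G k)"
      unfolding sum by (intro sum.cong refl retract G)
    also have "\<dots> \<in> Idl\<^bsub>mpol_ring V\<^esub> (G ` D)" by (intro genideal_mpol_ringI G vars)
    finally have "a \<in> rad (mpol_ring V) (G ` D)"
      unfolding rad_def mpol_ring_nat_pow using a
      by (intro CollectI conjI exI[of _ "Suc n"]) (auto simp: mpol_ring_def)
    with notin show False by contradiction
  qed
  from complex_nullstellensatz[OF J this] obtain \<chi> where
    \<chi>: "comm_ring_hom \<chi>" "\<And>c. \<chi> (mConst c) = c" "\<And>p. p \<in> J \<Longrightarrow> \<chi> p = 0"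
        "\<chi> (mpol_of_rat a) \<noteq> 0" by metis
  interpret X: comm_ring_hom \<chi> by fact
  have "comm_ring_hom (\<lambda>p. \<chi> (mpol_of_rat p))" by unfold_locales (simp_all add: E.hom_add
      E.hom_mult X.hom_add X.hom_mult)
  moreover have "\<chi> (mpol_of_rat (G k)) = 0" if "k \<in> D" for k
    unfolding J_def using that \<open>finite D\<close>
    by (intro \<chi>(3), unfold J_def, intro CollectI exI[of _ "\<lambda>i. if i = k then 1 else 0"])
      (simp add: if_distrib[of "\<lambda>x. x * _"] cong: if_cong)
  ultimately show ?thesis using that[of "\<lambda>p. \<chi> (mpol_of_rat p)"] \<chi>(2,4)
      by (simp add: mpol_of_rat_single)
qed

section \<open>Evaluation of $g_{d,e}$, $\alpha_{i,j,e}$ and $a_{d,e}$\<close>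

no_notation vec_index (infixl \<open>$\<close> 100)
unbundle fps_syntax

abbreviation exps_of_weight :: "nat \<Rightarrow> nat \<Rightarrow> (nat \<Rightarrow>\<^sub>0 nat) set" where
  "exps_of_weight e w \<equiv> {a \<in> exps e. eweight e a = w}"

text \<open>Without finiteness the sums in \<open>g_pol\<close> and \<open>alpha_pol\<close> would
  take the default value 0. Since indices start at 1, every exponent is at most the weight.\<close>

lemma finite_exps_of_weight: "finite (exps_of_weight e w)"
proof -
  let ?F = "{f. \<forall>i. (i \<in> {1..e} \<longrightarrow> f i \<in> {..w}) \<and> (i \<notin> {1..e} \<longrightarrow> f i = (0::nat))}"
  have "Poly_Mapping.lookup ` exps_of_weight e w \<subseteq> ?F"
  proof (intro image_subsetI CollectI allI conjI impI)
    fix a i assume a: "a \<in> exps_of_weight e w"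
    { assume i: "i \<in> {1..e}"
      have "i * Poly_Mapping.lookup a i \<le> eweight e a"
        unfolding eweight_def using i by (intro member_le_sum) auto
      moreover have "Poly_Mapping.lookup a i \<le> i * Poly_Mapping.lookup a i" using i by simp
      ultimately have "Poly_Mapping.lookup a i \<le> eweight e a" by (rule order_trans[rotated])
      then show "Poly_Mapping.lookup a i \<in> {..w}" using a by simp }
    { assume "i \<notin> {1..e}"
      then have "i \<notin> Poly_Mapping.keys a" using a by (auto simp: exps_def)
      then show "Poly_Mapping.lookup a i = 0" by (simp add: in_keys_iff) }
  qed
  moreover have "finite ?F" by (rule finite_set_of_finite_funs) auto
  ultimately have "finite (Poly_Mapping.lookup ` exps_of_weight e w)" by (rule finite_subset)
  then show ?thesis by (rule finite_imageD) (simp add: inj_on_def poly_mapping.lookup_inject)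
qed

definition mono_val :: "nat \<Rightarrow> (nat \<Rightarrow> 'a::comm_ring_1) \<Rightarrow> (nat \<Rightarrow>\<^sub>0 nat) \<Rightarrow> 'a" where
  "mono_val e x a = (\<Prod>i = 1..e. x i ^ Poly_Mapping.lookup a i)"

definition base_fps :: "nat \<Rightarrow> (nat \<Rightarrow> 'a::field) \<Rightarrow> 'a fps" where
  "base_fps e x = Abs_fps (\<lambda>i. if i = 0 then 1 else if i \<le> e then x i else 0)"

lemma base_fps_nth: "base_fps e x $ i = (if i = 0 then 1 else if i \<le> e then x i else 0)"
  by (simp add: base_fps_def)

text \<open>The multinomial expansion of the power -(m+1) of \<open>base_fps\<close>, collected by
  weight; \<open>multinom_fps_eq\<close> proves this by induction on m.\<close>

definition multinom_fps :: "nat \<Rightarrow> nat \<Rightarrow> (nat \<Rightarrow> 'a::field_char_0) \<Rightarrow> 'a fps" where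
  "multinom_fps e m x = Abs_fps (\<lambda>w. \<Sum>a\<in>exps_of_weight e w.
     (-1) ^ esize e a * of_rat (multinom e a m) * mono_val e x a)"

definition exps_fact :: "nat \<Rightarrow> (nat \<Rightarrow>\<^sub>0 nat) \<Rightarrow> 'a::field_char_0" where
  "exps_fact e a = (\<Prod>i = 1..e. fact (Poly_Mapping.lookup a i))"

lemma of_rat_multinom:
  "of_rat (multinom e a m) = (fact (esize e a + m) / (exps_fact e a * fact m) :: 'a::field_char_0)"
proof -
  have "of_rat (fact n) = (fact n :: 'a)" for n by (metis of_nat_fact of_rat_of_nat_eq)
  then show ?thesis
    by (simp add: multinom_def exps_fact_def of_rat_divide of_rat_mult of_rat_prod)
qed

lemma exps_fact_nonzero [simp]: "exps_fact e a \<noteq> 0"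
  by (simp add: exps_fact_def)

lemma add_single_exps:
  assumes "i \<in> {1..e}"
  shows "esize e (b + Poly_Mapping.single i 1) = Suc (esize e b)"
    and "eweight e (b + Poly_Mapping.single i 1) = eweight e b + i"
    and "mono_val e x (b + Poly_Mapping.single i 1) = x i * mono_val e x b"
    and "exps_fact e (b + Poly_Mapping.single i 1)
      = of_nat (Suc (Poly_Mapping.lookup b i)) * exps_fact e b"
    and "b + Poly_Mapping.single i 1 \<in> exps e \<longleftrightarrow> b \<in> exps e"
proof -
  have l: "Poly_Mapping.lookup (b + Poly_Mapping.single i 1) j
    = Poly_Mapping.lookup b j + (if j = i then 1 else 0)" for j
    by (simp add: lookup_add lookup_single when_def)
  show "esize e (b + Poly_Mapping.single i 1) = Suc (esize e b)"
    using assms unfolding esize_def l by (simp add: sum.distrib sum.delta)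
  show "eweight e (b + Poly_Mapping.single i 1) = eweight e b + i"
  proof -
    have "j * (Poly_Mapping.lookup b j + (if j = i then 1 else 0))
      = j * Poly_Mapping.lookup b j + (if j = i then i else 0)" for j by simp
    then show ?thesis using assms unfolding eweight_def l by (simp only: sum.distrib sum.delta) simp
  qed
  show "mono_val e x (b + Poly_Mapping.single i 1) = x i * mono_val e x b"
    using assms unfolding mono_val_def l
    by (simp add: power_add prod.distrib prod.delta if_distrib[of
        "power _"] mult.commute cong: if_cong)
  have "exps_fact e (b + Poly_Mapping.single i 1)
    = (\<Prod>j = 1..e. (if j = i then of_nat (Suc (Poly_Mapping.lookup b i)) else 1) * fact
        (Poly_Mapping.lookup b j) :: 'b)"
    unfolding exps_fact_def l by (intro prod.cong) auto
  then show "exps_fact e (b + Poly_Mapping.single i 1)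
      = of_nat (Suc (Poly_Mapping.lookup b i)) * (exps_fact e b :: 'b)"
    using assms by (simp add: exps_fact_def prod.distrib prod.delta)
  have "Poly_Mapping.keys (b + Poly_Mapping.single i 1) = insert i (Poly_Mapping.keys b)"
    unfolding set_eq_iff in_keys_iff l by (auto simp: in_keys_iff)
  then show "b + Poly_Mapping.single i 1 \<in> exps e \<longleftrightarrow> b \<in> exps e"
    using assms by (auto simp: exps_def)
qed

text \<open>Multiplication by x_i u^i raises the i-th exponent by one. Indexed by the raised vector
  a, the term carries the factor a_i, and summing over i turns these factors into |a|; the bracket
  is thus the Pascal rule for multinomial coefficients. The subtraction of 1 is truncated only when
  |a| = 0, where the factor |a| kills the term.\<close>

lemma base_fps_mult_nth:
  "(base_fps e x * multinom_fps e m x) $ w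
      = (\<Sum>a\<in>exps_of_weight e w. (-1) ^ esize e a * mono_val e x a *
     ((fact (esize e a + m) - fact (esize e a
         + m - 1) * of_nat (esize e a)) / (exps_fact e a * fact m)))"
proof -
  let ?T = "\<lambda>a. (-1) ^ esize e a * of_rat (multinom e a m) * mono_val e x a"
  let ?U = "\<lambda>a i. - ((-1) ^ esize e a * mono_val e x a *
     (fact (esize e a + m - 1) * of_nat (Poly_Mapping.lookup a i) / (exps_fact e a * fact m)))"
  have inner: "x i * (\<Sum>b | b \<in> exps e \<and> eweight e b + i = w. ?T b)
      = (\<Sum>a\<in>exps_of_weight e w. ?U a i)"
    if i: "i \<in> {1..e}" for i
  proof -
    have "x i * (\<Sum>b | b \<in> exps e \<and> eweight e b + i = w. ?T b)
      = (\<Sum>b | b \<in> exps e \<and> eweight e b + i = w. x i * ?T b)" by (rule sum_distrib_left)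
    also have "\<dots> = (\<Sum>a | a \<in> exps_of_weight e w \<and> Poly_Mapping.lookup a i \<noteq> 0. ?U a i)"
    proof (rule sum.reindex_bij_witness[where j = "\<lambda>b. b + Poly_Mapping.single i 1" and i =
        "\<lambda>a. a - Poly_Mapping.single i 1"])
      fix b assume b: "b \<in> {b. b \<in> exps e \<and> eweight e b + i = w}"
      show "b + Poly_Mapping.single i 1 - Poly_Mapping.single i 1 = b" by simp
      show "b + Poly_Mapping.single i 1 \<in> {a. a \<in> exps_of_weight e w \<and> Poly_Mapping.lookup a i \<noteq> 0}"
        using b add_single_exps(2,5)[OF i, where b = b] by (simp add: lookup_add)
      show "?U (b + Poly_Mapping.single i 1) i = x i * ?T b"
      proof -
        have "Poly_Mapping.lookup (b + Poly_Mapping.single i 1) i = Suc (Poly_Mapping.lookup b i)"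
          by (simp add: lookup_add)
        moreover have "r * c / (c * s * t) = r / (s * t)" if "c \<noteq> 0" for r s t c :: 'a
          using that by simp
        ultimately show ?thesis
          unfolding add_single_exps[OF i] of_rat_multinom by (simp add: mult_ac del: of_nat_Suc)
      qed
    next
      fix a assume a: "a \<in> {a. a \<in> exps_of_weight e w \<and> Poly_Mapping.lookup a i \<noteq> 0}"
      show eq: "a - Poly_Mapping.single i 1 + Poly_Mapping.single i 1 = a"
        using a by (intro poly_mapping_eqI) (auto
            simp: lookup_add lookup_minus lookup_single when_def)
      show "a - Poly_Mapping.single i 1 \<in> {b. b \<in> exps e \<and> eweight e b + i = w}"
        using a add_single_exps(2,5)[OF i, where b = "a - Poly_Mapping.single i 1"]
            unfolding eq by simp
    qed
    also have "\<dots> = (\<Sum>a\<in>exps_of_weight e w. ?U a i)"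
      by (rule sum.mono_neutral_left) (use finite_exps_of_weight in auto)
    finally show ?thesis .
  qed
  let ?S = "multinom_fps e m x"
  have "(base_fps e x * ?S) $ w = (\<Sum>i = 0..w. base_fps e x $ i * ?S $ (w - i))"
    by (simp add: fps_mult_nth)
  also have "\<dots> = ?S $ w + (\<Sum>i\<in>{1..w}. base_fps e x $ i * ?S $ (w - i))"
    by (subst sum.atLeast_Suc_atMost) (auto simp: base_fps_nth)
  finally have split: "(base_fps e x * ?S) $ w
    = ?S $ w + (\<Sum>i\<in>{1..w}. base_fps e x $ i * ?S $ (w - i))" .
  have "(\<Sum>i\<in>{1..w}. base_fps e x $ i * ?S $ (w - i))
    = (\<Sum>i\<in>{1..w} \<inter> {1..e}. x i * ?S $ (w - i))"
    by (rule sum.mono_neutral_cong_right) (auto simp: base_fps_nth)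
  also have "\<dots> = (\<Sum>i\<in>{1..w} \<inter> {1..e}. x i * (\<Sum>b | b \<in> exps e \<and> eweight e b + i = w. ?T b))"
    by (intro sum.cong refl arg_cong2[of _ _ _ _ "(*)"])
      (auto simp: multinom_fps_def intro!: sum.cong)
  also have "\<dots> = (\<Sum>i\<in>{1..e}. x i * (\<Sum>b | b \<in> exps e \<and> eweight e b + i = w. ?T b))"
  proof (rule sum.mono_neutral_left)
    show "\<forall>i\<in>{1..e} - {1..w} \<inter> {1..e}. x i * (\<Sum>b | b \<in> exps e \<and> eweight e b + i = w. ?T b) = 0"
    proof
      fix i assume "i \<in> {1..e} - {1..w} \<inter> {1..e}"
      then have "{b. b \<in> exps e \<and> eweight e b + i = w} = {}" by auto
      then show "x i * (\<Sum>b | b \<in> exps e \<and> eweight e b + i = w. ?T b) = 0"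
        by (simp only: sum.empty mult_zero_right)
    qed
  qed auto
  also have "\<dots> = (\<Sum>i\<in>{1..e}. \<Sum>a\<in>exps_of_weight e w. ?U a i)" by (intro sum.cong refl inner)
  also have "\<dots> = (\<Sum>a\<in>exps_of_weight e w. \<Sum>i\<in>{1..e}. ?U a i)" by (rule sum.swap)
  finally have tail: "(\<Sum>i\<in>{1..w}. base_fps e x $ i * ?S $ (w - i))
    = (\<Sum>a\<in>exps_of_weight e w. \<Sum>i\<in>{1..e}. ?U a i)" .
  have head: "?S $ w = (\<Sum>a\<in>exps_of_weight e w. ?T a)" by (simp add: multinom_fps_def)
  show ?thesis unfolding split tail unfolding head sum.distrib[symmetric]
  proof (rule sum.cong[OF refl])
    fix a
    have "(\<Sum>i\<in>{1..e}. ?U a i) = - ((-1) ^ esize e a * mono_val e x a *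
     (fact (esize e a + m - 1) * of_nat (esize e a) / (exps_fact e a * fact m)))"
      by (simp add: sum_negf sum_distrib_left[symmetric] sum_divide_distrib[symmetric] esize_def)
    then show "?T a + (\<Sum>i\<in>{1..e}. ?U a i) = (-1) ^ esize e a * mono_val e x a *
     ((fact (esize e a + m) - fact (esize e a
         + m - 1) * of_nat (esize e a)) / (exps_fact e a * fact m))"
      by (simp add: of_rat_multinom diff_divide_distrib algebra_simps)
  qed
qed

text \<open>The bracket of \<open>base_fps_mult_nth\<close> collapses: (|a|+m+1)! - |a| (|a|+m)! =
  (m+1) (|a|+m)!.\<close>

lemma multinom_fps_Suc: "base_fps e x * multinom_fps e (Suc m) x = multinom_fps e m x"
proof (rule fps_ext)
  fix w
  have "((fact (esize e a + Suc m) - fact (esize e a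
      + Suc m - 1) * of_nat (esize e a)) / (exps_fact e a * fact (Suc m)) :: 'a)
    = of_rat (multinom e a m)" for a
  proof -
    have "fact (esize e a + Suc m) - fact (esize e a + Suc m - 1) * of_nat (esize e a)
      = (of_nat (Suc m) * fact (esize e a + m) :: 'a)"
    proof -
      have "fact (esize e a + Suc m) = (of_nat (esize e a) + of_nat (Suc m)) * (fact (esize e a
          + m) :: 'a)"
        by (simp only: add_Suc_right fact_Suc of_nat_add[symmetric])
      then show ?thesis by (simp add: distrib_right)
    qed
    moreover have "c * r / (s * (c * t)) = r / (s * t)" if "c \<noteq> 0" for r s t c :: 'a
      using that by simp
    ultimately show ?thesis unfolding of_rat_multinom fact_Suc
        by (simp only: of_nat_neq_0 not_False_eq_True)
  qed
  then show "(base_fps e x * multinom_fps e (Suc m) x) $ w = multinom_fps e m x $ w"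
    unfolding base_fps_mult_nth by (simp add: multinom_fps_def mult_ac)
qed

text \<open>For m = 0 the bracket |a|! - |a| (|a|-1)! vanishes unless a = 0.\<close>

lemma multinom_fps_0: "base_fps e x * multinom_fps e 0 x = 1"
proof (rule fps_ext)
  fix w
  have zero: "a = 0" if "a \<in> exps e" "esize e a = 0" for a
    using that by (intro poly_mapping_eqI) (force simp: esize_def exps_def in_keys_iff)
  have z: "esize e 0 = 0" "eweight e 0 = 0" "exps_fact e 0 = 1" "mono_val e x 0 = 1" "0 \<in> exps e"
    by (simp_all add: esize_def eweight_def exps_fact_def mono_val_def exps_def)
  have "(base_fps e x * multinom_fps e 0 x) $ w = (\<Sum>a\<in>exps_of_weight e w. if a = 0 then 1 else 0)"
    unfolding base_fps_mult_nth
  proof (rule sum.cong[OF refl])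
    fix a assume a: "a \<in> exps_of_weight e w"
    show "(- 1) ^ esize e a * mono_val e x a *
         ((fact (esize e a + 0) - fact (esize e a + 0 - 1) * of_nat (esize e a)) /
          (exps_fact e a * fact 0)) = (if a = 0 then 1 else 0)"
    proof (cases "a = 0")
      case False
      then have "esize e a \<noteq> 0" using zero a by blast
      then have "(fact (esize e a) :: 'a) = of_nat (esize e a) * fact (esize e a - 1)"
          by (metis fact_reduce gr0I)
      with False show ?thesis by simp
    qed (simp add: z)
  qed
  also have "\<dots> = (if 0 \<in> exps_of_weight e w then 1 else 0)"
    using finite_exps_of_weight by (simp add: sum.delta)
  also have "\<dots> = 1 $ w" using z by simp
  finally show "(base_fps e x * multinom_fps e 0 x) $ w = 1 $ w" .
qed

lemma multinom_fps_eq: "multinom_fps e m x = inverse (base_fps e x) ^ Suc m"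
proof -
  have inv: "inverse (base_fps e x) * base_fps e x = 1"
    by (rule inverse_mult_eq_1) (simp add: base_fps_nth)
  show ?thesis
  proof (induction m)
    case 0
    have "multinom_fps e 0 x = (inverse (base_fps e x) * base_fps e x) * multinom_fps e 0 x"
        by (simp add: inv)
    also have "\<dots> = inverse (base_fps e x) * (base_fps e x * multinom_fps e 0 x)"
        by (simp only: mult.assoc)
    finally show ?case by (simp add: multinom_fps_0)
  next
    case (Suc m)
    have "multinom_fps e (Suc m) x = (inverse (base_fps e x) * base_fps e x) * multinom_fps e (Suc
        m) x" by (simp add: inv)
    also have "\<dots> = inverse (base_fps e x) * (base_fps e x * multinom_fps e (Suc m) x)"
        by (simp only: mult.assoc)
    finally show ?case by (simp add: multinom_fps_Suc Suc)
  qed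
qed

text \<open>The right-hand side of Lagrange's formula for coefficient k+1 of the inverse of u P(u).
  It equals the evaluation of \<open>g_pol\<close> by \<open>hom_g_pol\<close>.\<close>

definition g_val :: "nat \<Rightarrow> nat \<Rightarrow> (nat \<Rightarrow> 'a::field_char_0) \<Rightarrow> 'a" where
  "g_val e k x = (inverse (base_fps e x) ^ Suc k) $ k / of_nat (Suc k)"

text \<open>Minus the derivative of \<open>g_val e (j + 1)\<close> in the variable x_(i+1):
  differentiating P^(-(j+2)) / (j+2) yields the exponent j+3 and the shift by u^(i+1). Hence column
  d-1+k of the matrix belongs to g_(d+k).\<close>

definition alpha_val :: "nat \<Rightarrow> nat \<Rightarrow> nat \<Rightarrow> (nat \<Rightarrow> 'a::field_char_0) \<Rightarrow> 'a" where
  "alpha_val e i j x = (if i \<le> j then (inverse (base_fps e x) ^ (j + 3)) $ (j - i) else 0)"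

text \<open>Such a \<chi> is evaluation at the point with coordinates
  \<open>\<chi> (mVar i)\<close>; the Nullstellensatz delivers points in this form.\<close>

context
  fixes \<chi> :: "(nat, rat) mpol \<Rightarrow> 'a::field_char_0"
  assumes hom: "comm_ring_hom \<chi>" and const: "\<And>q. \<chi> (mConst q) = of_rat q"
begin

interpretation comm_ring_hom \<chi> by (rule hom)

lemma hom_single:
  assumes "a \<in> exps e"
  shows "\<chi> (Poly_Mapping.single a c) = of_rat c * mono_val e (\<lambda>i. \<chi> (mVar i)) a"
proof -
  have pow: "mVar v ^ k = (Poly_Mapping.single (Poly_Mapping.single v k) 1 :: (nat, rat) mpol)"
      for v :: nat and k
    by (induction k) (simp_all add: mult_single single_add[symmetric] del: One_nat_def add:
        plus_1_eq_Suc)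
  have "(\<Prod>i\<in>A. mVar i ^ Poly_Mapping.lookup a i)
    = (Poly_Mapping.single (\<Sum>i\<in>A. Poly_Mapping.single i (Poly_Mapping.lookup a i)) 1 :: (nat, rat)
        mpol)"
    if "finite A" for A using that by induction (simp_all add: pow mult_single del: One_nat_def)
  from this[of "{1..e}"]
  have "(\<Prod>i = 1..e. mVar i ^ Poly_Mapping.lookup a i)
    = (Poly_Mapping.single (\<Sum>i = 1..e. Poly_Mapping.single i (Poly_Mapping.lookup a i)) 1 :: (nat,
        rat) mpol)"
    by simp
  also have "(\<Sum>i = 1..e. Poly_Mapping.single i (Poly_Mapping.lookup a i)) = a"
  proof (rule poly_mapping_eqI)
    fix k
    have "(\<Sum>i = 1..e. Poly_Mapping.lookup (Poly_Mapping.single i (Poly_Mapping.lookup a i)) k)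
      = (\<Sum>i = 1..e. if i = k then Poly_Mapping.lookup a i else 0)"
      by (intro sum.cong) (auto simp: lookup_single when_def)
    also have "\<dots> = Poly_Mapping.lookup a k"
    proof (cases "k \<in> {1..e}")
      case False
      then have "k \<notin> Poly_Mapping.keys a" using assms by (auto simp: exps_def)
      with False show ?thesis by (auto simp: in_keys_iff)
    qed (auto simp: sum.delta)
    finally show "Poly_Mapping.lookup (\<Sum>i
        = 1..e. Poly_Mapping.single i (Poly_Mapping.lookup a i)) k = Poly_Mapping.lookup a k"
      by (simp add: lookup_sum)
  qed
  finally have "Poly_Mapping.single a c = mConst c * (\<Prod>i = 1..e. mVar i ^ Poly_Mapping.lookup a i)"
    by (simp add: mult_single)
  then show ?thesis by (simp add: hom_mult hom_prod hom_power const mono_val_def del: One_nat_def)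
qed

lemma hom_g_pol: "\<chi> (g_pol k e) = g_val e k (\<lambda>i. \<chi> (mVar i))"
proof -
  let ?x = "\<lambda>i. \<chi> (mVar i)"
  have "\<chi> (g_pol k e) = (\<Sum>a\<in>exps_of_weight e k.
    of_rat (1 / of_nat (k + 1) * (- 1) ^ esize e a * multinom e a k) * mono_val e ?x a)"
    unfolding g_pol_def hom_sum by (intro sum.cong refl hom_single) simp
  also have "\<dots> = 1 / of_nat (Suc k) * multinom_fps e k ?x $ k"
    by (simp add: multinom_fps_def sum_distrib_left of_rat_mult of_rat_divide of_rat_power
        of_rat_minus mult_ac of_rat_add)
  finally show ?thesis by (simp add: g_val_def multinom_fps_eq)
qed

lemma hom_alpha_pol: "\<chi> (alpha_pol i j e) = alpha_val e i j (\<lambda>i. \<chi> (mVar i))"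
proof (cases "i \<le> j")
  case True
  let ?x = "\<lambda>i. \<chi> (mVar i)"
  have "\<chi> (alpha_pol i j e) = (\<Sum>a | a \<in> exps e \<and> i + eweight e a = j.
    of_rat ((- 1) ^ esize e a * multinom e a (j + 2)) * mono_val e ?x a)"
    unfolding alpha_pol_def hom_sum by (intro sum.cong refl hom_single) simp
  also have "{a. a \<in> exps e \<and> i + eweight e a = j} = exps_of_weight e (j - i)" using True by auto
  also have "(\<Sum>a\<in>\<dots>. of_rat ((- 1) ^ esize e a * multinom e a (j + 2)) * mono_val e ?x a)
    = multinom_fps e (j + 2) ?x $ (j - i)"
    by (simp add: multinom_fps_def of_rat_mult of_rat_power of_rat_minus)
  finally show ?thesis using True by (simp add: alpha_val_def multinom_fps_eq numeral_3_eq_3)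
next
  case False
  then have "{a. a \<in> exps e \<and> i + eweight e a = j} = {}" by auto
  with False show ?thesis by (simp add: alpha_val_def alpha_pol_def)
qed

lemma hom_a_pol: "\<chi> (a_pol d e) = det (mat e e (\<lambda>(i, k). alpha_val e i (d - 1
    + k) (\<lambda>i. \<chi> (mVar i))))"
proof -
  have "\<chi> (a_pol d e) = det (map_mat \<chi> (mat e e (\<lambda>(i, k). alpha_pol i (d - 1 + k) e)))"
    by (simp add: a_pol_def hom_det)
  also have "map_mat \<chi> (mat e e (\<lambda>(i, k). alpha_pol i (d - 1 + k) e))
    = mat e e (\<lambda>(i, k). alpha_val e i (d - 1 + k) (\<lambda>i. \<chi> (mVar i)))"
    by (rule eq_matI) (simp_all add: hom_alpha_pol)
  finally show ?thesis .
qed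

end

section \<open>The complex point provided by PIC\<close>

lemma carrier_mpol_ring: "carrier (mpol_ring V) = {p. mpol_vars p \<subseteq> V}"
  by (simp add: mpol_ring_def)

lemma ideal_hom_kernel:
  fixes h :: "('v, 'a::comm_ring_1) mpol \<Rightarrow> 'b::comm_ring_1"
  assumes "comm_ring_hom h"
  shows "ideal {p. mpol_vars p \<subseteq> V \<and> h p = 0} (mpol_ring V)"
proof -
  interpret comm_ring_hom h by fact
  interpret R: cring "mpol_ring V :: ('v, 'a) mpol ring" by (rule cring_mpol_ring)
  have uminus: "\<ominus>\<^bsub>mpol_ring V\<^esub> p = - p" if "mpol_vars p \<subseteq> V" for p :: "('v, 'a) mpol"
    using that by (intro R.minus_equality) (simp_all add: mpol_ring_def mpol_vars_uminus)
  have "subgroup {p. mpol_vars p \<subseteq> V \<and> h p = 0} (add_monoid (mpol_ring V))"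
  proof (rule R.add.subgroupI)
    show "{p. mpol_vars p \<subseteq> V \<and> h p = 0} \<noteq> {}"
      by (intro ex_in_conv[THEN iffD1] exI[of _ 0]) (simp add: mpol_vars_def)
    show "\<ominus>\<^bsub>mpol_ring V\<^esub> p \<in> {p. mpol_vars p \<subseteq> V \<and> h p = 0}" if "p \<in> {p. mpol_vars p \<subseteq> V \<and> h p
        = 0}" for p :: "('v, 'a) mpol"
    proof -
      have "h (- p) = 0" using that hom_mult[of "-1" p] by simp
      then show ?thesis using that by (simp add: uminus mpol_vars_uminus)
    qed
    show "p \<oplus>\<^bsub>mpol_ring V\<^esub> q \<in> {p. mpol_vars p \<subseteq> V \<and> h p = 0}"
      if "p \<in> {p. mpol_vars p \<subseteq> V \<and> h p = 0}" "q \<in> {p. mpol_vars p \<subseteq> V \<and> h p = 0}" for p q ::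
          "('v, 'a) mpol"
      using that mpol_vars_add[of p q] by (auto simp: mpol_ring_def hom_add)
  qed (auto simp: mpol_ring_def)
  then show ?thesis
  proof (intro idealI R.ring_axioms)
    fix p q :: "('v, 'a) mpol" assume *: "p \<in> {p. mpol_vars p \<subseteq> V \<and> h p = 0}" "q
        \<in> carrier (mpol_ring V)"
    then have "mpol_vars (p * q) \<subseteq> V" "mpol_vars (q * p) \<subseteq> V"
      using mpol_vars_mult[of p q] mpol_vars_mult[of q p] by (auto simp: mpol_ring_def)
    with * show "q \<otimes>\<^bsub>mpol_ring V\<^esub> p \<in> {p. mpol_vars p \<subseteq> V \<and> h p = 0}"
      "p \<otimes>\<^bsub>mpol_ring V\<^esub> q \<in> {p. mpol_vars p \<subseteq> V \<and> h p = 0}"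
      by (auto simp: mpol_ring_def hom_mult)
  qed
qed

lemma hom_genideal_zero:
  fixes h :: "('v, 'a::comm_ring_1) mpol \<Rightarrow> 'b::comm_ring_1"
  assumes "comm_ring_hom h" "\<And>p. p \<in> S \<Longrightarrow> mpol_vars p \<subseteq> V \<and> h p = 0" "p \<in> Idl\<^bsub>mpol_ring V\<^esub> S"
  shows "h p = 0"
proof -
  interpret R: cring "mpol_ring V :: ('v, 'a) mpol ring" by (rule cring_mpol_ring)
  have "Idl\<^bsub>mpol_ring V\<^esub> S \<subseteq> {p. mpol_vars p \<subseteq> V \<and> h p = 0}"
    by (rule R.genideal_minimal) (use ideal_hom_kernel assms in auto)
  with assms(3) show ?thesis by blast
qed

text \<open>This is evaluation at the origin; it is multiplicative because two exponent vectors add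
  up to 0 only if both are 0.\<close>

lemma comm_ring_hom_constant_coeff:
  "comm_ring_hom (\<lambda>p :: ('v, 'a::comm_ring_1) mpol. Poly_Mapping.lookup p 0)"
proof
  fix p q :: "('v, 'a) mpol"
  have nat0: "m + n = 0 \<longleftrightarrow> m = 0 \<and> n = 0" for m n :: "'v \<Rightarrow>\<^sub>0 nat"
  proof
    assume "m + n = 0"
    then have "Poly_Mapping.lookup m v + Poly_Mapping.lookup n v = 0" for v
      by (metis lookup_add lookup_zero)
    then show "m = 0 \<and> n = 0" by (auto intro!: poly_mapping_eqI)
  qed simp
  show "Poly_Mapping.lookup (p * q) 0 = Poly_Mapping.lookup p 0 * Poly_Mapping.lookup q 0"
    by (rule biadditive_eqI[of "\<lambda>p q. Poly_Mapping.lookup (p * q) 0"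
        "\<lambda>p q. Poly_Mapping.lookup p 0 * Poly_Mapping.lookup q 0"])
      (simp_all add: lookup_add distrib_left distrib_right mult_single lookup_single when_def nat0)
qed (simp_all add: lookup_add)

lemma mpol_vars_g_pol: "mpol_vars (g_pol k e) \<subseteq> {1..e}"
  unfolding g_pol_def by (intro mpol_vars_sum order_trans[OF mpol_vars_single]) (auto
      simp: exps_def)

lemma mpol_vars_alpha_pol: "mpol_vars (alpha_pol i j e) \<subseteq> {1..e}"
  unfolding alpha_pol_def by (intro mpol_vars_sum order_trans[OF mpol_vars_single]) (auto
      simp: exps_def)

lemma mpol_vars_a_pol: "mpol_vars (a_pol d e) \<subseteq> {1..e}"
proof -
  let ?A = "mat e e (\<lambda>(i, k). alpha_pol i (d - 1 + k) e)"
  have "mpol_vars (signof p * (\<Prod>i = 0..<e. ?A $$ (i, p i))) \<subseteq> {1..e}" if p: "p permutes {0..<e}"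
      for p
  proof -
    have "mpol_vars (signof p :: (nat, rat) mpol) \<subseteq> {1..e}"
      by (auto simp: sign_def mpol_vars_uminus) (auto simp: mpol_vars_def)
    moreover have "mpol_vars (\<Prod>i = 0..<e. ?A $$ (i, p i)) \<subseteq> {1..e}"
    proof (rule mpol_vars_prod)
      fix i assume i: "i \<in> {0..<e}"
      then have "p i \<in> {0..<e}" by (simp only: permutes_in_image[OF p])
      with i show "mpol_vars (?A $$ (i, p i)) \<subseteq> {1..e}" using mpol_vars_alpha_pol by simp
    qed
    ultimately show ?thesis
      by (intro order_trans[OF mpol_vars_mult] Un_least)
  qed
  then show ?thesis unfolding a_pol_def det_def by (auto intro!: mpol_vars_sum)
qed

text \<open>The g_k have no constant term, so the maximal ideal rad(g_d, ..., g_(d+e-1)) lies in the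
  ideal of the origin and therefore equals it. If g_(d+e-1) vanished too at the point found for
  a_(d,e), that point would be the origin. There P = 1, and row 0 of the matrix, with entries
  \<alpha>_(0,j) for j \<ge> d-1 \<ge> 1, is zero, so the determinant would vanish.\<close>

lemma PIC_point:
  assumes "d \<ge> 2" "e \<ge> 1" "PIC d e"
  obtains x :: "nat \<Rightarrow> complex" where "\<And>k. d \<le> k \<Longrightarrow> k < d + e - 1 \<Longrightarrow> g_val e k x = 0"
    "g_val e (d + e - 1) x \<noteq> 0" "det (mat e e (\<lambda>(i, k). alpha_val e i (d - 1 + k) x)) \<noteq> 0"
proof -
  let ?R = "mpol_ring {1..e} :: (nat, rat) mpol ring" and ?G = "\<lambda>k. g_pol k e"
  have max: "maximalideal (rad ?R (?G ` {d..<d + e})) ?R"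
    and a: "a_pol d e \<notin> rad ?R (?G ` {d..<d + e - 1})"
    using assms(3) unfolding PIC_def Let_def by auto
  obtain \<chi> :: "(nat, rat) mpol \<Rightarrow> complex" where \<chi>: "comm_ring_hom \<chi>"
    "\<And>q. \<chi> (mConst q) = of_rat q" "\<And>k. k \<in> {d..<d + e - 1} \<Longrightarrow> \<chi> (?G k) = 0" "\<chi> (a_pol d e) \<noteq> 0"
    by (rule rational_nullstellensatz[OF finite_atLeastLessThan mpol_vars_g_pol mpol_vars_a_pol
        a]) blast
  interpret comm_ring_hom \<chi> by fact
  define x where "x i = \<chi> (mVar i)" for i
  have g: "\<chi> (?G k) = g_val e k x" for k unfolding x_def by (rule hom_g_pol[OF \<chi>(1,2)])
  have det: "\<chi> (a_pol d e) = det (mat e e (\<lambda>(i, k). alpha_val e i (d - 1 + k) x))"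
    unfolding x_def by (rule hom_a_pol[OF \<chi>(1,2)])
  have "g_val e (d + e - 1) x \<noteq> 0"
  proof
    assume "g_val e (d + e - 1) x = 0"
    with g \<chi>(3) have kill: "\<chi> (?G k) = 0" if "k \<in> {d..<d + e}" for k
      using that by (cases "k = d + e - 1") auto
    let ?Z = "{p. mpol_vars p \<subseteq> {1..e} \<and> Poly_Mapping.lookup p 0 = (0::rat)}"
    interpret K: comm_ring_hom "\<lambda>p :: (nat, rat) mpol. Poly_Mapping.lookup p 0"
      by (rule comm_ring_hom_constant_coeff)
    have g0: "Poly_Mapping.lookup (?G k) 0 = 0" if "k \<in> {d..<d + e}" for k
      using that assms(1) by (auto simp: g_pol_def lookup_sum lookup_single when_def eweight_def
          intro!: sum.neutral)
    have Z: "ideal ?Z ?R" by (rule ideal_hom_kernel[OF comm_ring_hom_constant_coeff])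
    have "rad ?R (?G ` {d..<d + e}) \<subseteq> ?Z"
    proof
      fix p assume "p \<in> rad ?R (?G ` {d..<d + e})"
      then obtain n where n: "mpol_vars p \<subseteq> {1..e}" "p ^ n \<in> Idl\<^bsub>?R\<^esub> (?G ` {d..<d + e})"
        by (auto simp: rad_def mpol_ring_nat_pow carrier_mpol_ring)
      have "Poly_Mapping.lookup (p ^ n) 0 = 0"
        by (rule hom_genideal_zero[OF comm_ring_hom_constant_coeff _ n(2)]) (use g0
            mpol_vars_g_pol in auto)
      then show "p \<in> ?Z" using n(1) by (simp add: K.hom_power)
    qed
    moreover have "?Z \<noteq> carrier ?R"
    proof
      assume "?Z = carrier ?R"
      moreover have "1 \<in> carrier ?R" by (simp add: mpol_ring_def mpol_vars_def)
      ultimately have "(1 :: (nat, rat) mpol) \<in> ?Z" by (simp only:)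
      then show False by simp
    qed
    moreover have "?Z \<subseteq> carrier ?R" by (auto simp: mpol_ring_def)
    ultimately have Z_eq: "?Z = rad ?R (?G ` {d..<d + e})"
      using maximalideal.I_maximal[OF max Z] by blast
    have x0: "x i = 0" if i: "i \<in> {1..e}" for i
    proof -
      have "Poly_Mapping.single i 1 \<noteq> (0 :: nat \<Rightarrow>\<^sub>0 nat)"
          by (metis lookup_single_eq lookup_zero one_neq_zero)
      then have "mVar i \<in> ?Z" using i by (simp add: mpol_vars_def lookup_single_not_eq)
      then have "mVar i \<in> rad ?R (?G ` {d..<d + e})" unfolding Z_eq .
      then obtain n where n: "n > 0" "mVar i ^ n \<in> Idl\<^bsub>?R\<^esub> (?G ` {d..<d + e})"
        by (auto simp: rad_def mpol_ring_nat_pow)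
      have "\<chi> (mVar i ^ n) = 0"
        by (rule hom_genideal_zero[OF \<chi>(1) _ n(2)]) (use kill mpol_vars_g_pol in auto)
      then show ?thesis by (simp add: x_def hom_power)
    qed
    then have "base_fps e x = 1" by (intro fps_ext) (auto simp: base_fps_nth)
    then have "alpha_val e 0 j x = 0" if "j \<ge> 1" for j using that by (simp add: alpha_val_def)
    then have "det (mat e e (\<lambda>(i, k). alpha_val e i (d - 1 + k) x)) = 0"
      using assms(1,2) by (subst laplace_expansion_row[of _ e 0]) auto
    with det \<chi>(4) show False by simp
  qed
  moreover have "g_val e k x = 0" if "d \<le> k" "k < d + e - 1" for k using \<chi>(3)[of k] g that by simp
  ultimately show ?thesis using that \<chi>(4) det by metis
qed

section \<open>Lagrange inversion and the curve\<close>

text \<open>With f = u P(u) this coefficient is the residue of f' / f^(n+1). For n > 0 that is the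
  derivative of a Laurent series and has no residue; for n = 0 it is a logarithmic derivative with
  residue 1. Writing it with powers of the invertible P avoids negative exponents of u.\<close>

lemma deriv_power_residue:
  fixes P :: "'a::field_char_0 fps"
  assumes "P $ 0 = 1"
  shows "(inverse P ^ Suc n * fps_deriv (fps_X * P)) $ n = (if n = 0 then 1 else 0)"
proof -
  let ?Q = "inverse P"
  have PQ: "?Q * P = 1" using assms by (simp add: inverse_mult_eq_1)
  have "?Q ^ Suc n * fps_deriv (fps_X * P) = ?Q ^ n * (?Q * P) + fps_X * (?Q ^ Suc n * fps_deriv P)"
    by (simp add: algebra_simps)
  then have eq: "?Q ^ Suc n * fps_deriv (fps_X * P) = ?Q ^ n + fps_X * (?Q ^ Suc n * fps_deriv P)"
    by (simp add: PQ)
  show ?thesis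
  proof (cases n)
    case 0
    then show ?thesis unfolding eq using assms by simp
  next
    case (Suc k)
    have "fps_deriv ?Q = - fps_deriv P * ?Q ^ 2"
      by (rule fps_inverse_deriv) (use assms in simp)
    then have d: "fps_deriv (?Q ^ Suc k) = - of_nat (Suc k) * (?Q ^ Suc n * fps_deriv P)"
      unfolding fps_deriv_power' Suc by (simp add: power2_eq_square algebra_simps)
    have "of_nat (Suc k) * (?Q ^ n) $ n = fps_deriv (?Q ^ Suc k) $ k"
      unfolding Suc fps_deriv_nth by (simp only: Suc_eq_plus1)
    also have "\<dots> = - of_nat (Suc k) * (?Q ^ Suc n * fps_deriv P) $ k"
      unfolding d by (simp only: fps_of_nat[symmetric] mult_minus_left fps_neg_nth
          fps_mult_left_const_nth)
    finally have "of_nat (Suc k) * ((?Q ^ n) $ n + (?Q ^ Suc n * fps_deriv P) $ k) = 0"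
      by (simp only: distrib_left mult_minus_left) simp
    then have "(?Q ^ n) $ n + (?Q ^ Suc n * fps_deriv P) $ k = 0"
      by (simp only: mult_eq_0_iff of_nat_eq_0_iff) simp
    then show ?thesis unfolding eq by (simp add: Suc)
  qed
qed

text \<open>Differentiating h(f) = u gives h'(f) f' = 1. Expand h'(f) in powers of f: among the
  residues of f^j f' / f^(n+1) only the one with j = n is nonzero. It singles out coefficient n of
  h', which is n+1 times coefficient n+1 of h.\<close>

theorem fps_lagrange_inversion:
  fixes P :: "'a::field_char_0 fps"
  assumes P: "P $ 0 = 1"
  shows "fps_inv (fps_X * P) $ Suc n = (inverse P ^ Suc n) $ n / of_nat (Suc n)"
proof -
  let ?f = "fps_X * P" and ?Q = "inverse P"
  let ?h = "fps_inv ?f"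
  have PQ: "P * ?Q = 1" using P by (simp add: inverse_mult_eq_1')
  have "?h oo ?f = fps_X" by (rule fps_inv) (use P in auto)
  then have "(fps_deriv ?h oo ?f) * fps_deriv ?f = 1"
    using fps_compose_deriv[of ?f ?h] by simp
  then have "?Q ^ Suc n = (fps_deriv ?h oo ?f) * (?Q ^ Suc n * fps_deriv ?f)"
    by (simp only: mult.left_commute[of _ "?Q ^ Suc n"]) simp
  then have "(?Q ^ Suc n) $ n = (\<Sum>i=0..n. (fps_deriv ?h oo ?f) $ i * (?Q ^ Suc n * fps_deriv ?f) $
      (n - i))"
    by (metis fps_mult_nth)
  also have "\<dots> = (\<Sum>i=0..n. (\<Sum>j=0..n. fps_deriv ?h $ j * (?f ^ j) $ i) * (?Q ^ Suc n * fps_deriv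
      ?f) $ (n - i))"
  proof (intro sum.cong refl arg_cong2[of _ _ _ _ "(*)"])
    fix i assume i: "i \<in> {0..n}"
    show "(fps_deriv ?h oo ?f) $ i = (\<Sum>j=0..n. fps_deriv ?h $ j * (?f ^ j) $ i)"
      unfolding fps_compose_nth
      by (rule sum.mono_neutral_left) (use i in \<open>auto
          simp: power_mult_distrib fps_X_power_mult_nth\<close>)
  qed
  also have "\<dots> = (\<Sum>j=0..n. fps_deriv ?h $ j * (\<Sum>i=0..n. (?f ^ j) $ i * (?Q ^ Suc n * fps_deriv ?f)
      $ (n - i)))"
    by (simp only: sum_distrib_right sum_distrib_left mult.assoc) (rule sum.swap)
  also have "\<dots> = (\<Sum>j=0..n. fps_deriv ?h $ j * (if j = n then 1 else 0))"
  proof (intro sum.cong refl arg_cong2[of _ _ _ _ "(*)"])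
    fix j assume j: "j \<in> {0..n}"
    have "P ^ j * ?Q ^ j = 1" using PQ by (simp add: power_mult_distrib[symmetric])
    moreover have "Suc n = j + Suc (n - j)" using j by simp
    ultimately have red: "P ^ j * ?Q ^ Suc n = ?Q ^ Suc (n - j)"
      by (metis mult.assoc mult.left_neutral power_add)
    have "(\<Sum>i=0..n. (?f ^ j) $ i * (?Q ^ Suc n * fps_deriv ?f) $ (n - i))
        = (?f ^ j * (?Q ^ Suc n * fps_deriv ?f)) $ n"
      by (rule fps_mult_nth[symmetric])
    also have "?f ^ j * (?Q ^ Suc n * fps_deriv ?f) = fps_X ^ j * (?Q ^ Suc (n - j) * fps_deriv ?f)"
      unfolding red[symmetric] by (simp only: power_mult_distrib mult_ac)
    also have "\<dots> $ n = (?Q ^ Suc (n - j) * fps_deriv ?f) $ (n - j)"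
      using j by (simp add: fps_X_power_mult_nth)
    also have "\<dots> = (if j = n then 1 else 0)" using deriv_power_residue[OF P, of "n - j"] j by auto
    finally show "(\<Sum>i=0..n. (?f ^ j) $ i * (?Q ^ Suc n * fps_deriv ?f) $ (n - i)) = (if j
        = n then 1 else 0)" .
  qed
  also have "\<dots> = of_nat (Suc n) * ?h $ Suc n" by (simp add: if_distrib[of "(*) _"] cong: if_cong)
  finally show ?thesis by (metis nonzero_mult_div_cancel_left of_nat_neq_0)
qed

lemma g_val_eq_fps_inv: "g_val e k y = fps_inv (fps_X * base_fps e y) $ Suc k"
  unfolding g_val_def by (rule fps_lagrange_inversion[symmetric]) (simp add: base_fps_nth)

text \<open>Replacing x_i by z^i x_i is the substitution u -> z u in P, so g_k is isobaric of weight
  k.\<close>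

lemma g_val_scale:
  fixes z :: "'a::field_char_0"
  shows "g_val e k (\<lambda>i. z ^ i * x i) = z ^ k * g_val e k x"
proof -
  let ?z = "fps_const z * fps_X" and ?P = "base_fps e x"
  have "base_fps e (\<lambda>i. z ^ i * x i) = ?P oo ?z"
    by (rule fps_ext) (simp add: fps_nth_compose_linear base_fps_nth)
  moreover have "inverse (?P oo ?z) = inverse ?P oo ?z"
    by (rule fps_inverse_compose[symmetric]) (simp_all add: base_fps_nth)
  moreover have "(inverse ?P oo ?z) ^ Suc k = inverse ?P ^ Suc k oo ?z"
    by (rule fps_compose_power) simp
  ultimately show ?thesis
    by (simp only: g_val_def fps_nth_compose_linear times_divide_eq_right)
qed

section \<open>Quantities depending polynomially on z\<close>

definition polyfun :: "(complex \<Rightarrow> complex) \<Rightarrow> bool" where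
  "polyfun f \<longleftrightarrow> (\<exists>p. \<forall>z. f z = poly p z)"

lemma polyfun_poly [intro, simp]: "polyfun (poly p)"
  and polyfun_const [intro, simp]: "polyfun (\<lambda>_. c)"
  and polyfun_add: "polyfun f \<Longrightarrow> polyfun g \<Longrightarrow> polyfun (\<lambda>z. f z + g z)"
  and polyfun_diff: "polyfun f \<Longrightarrow> polyfun g \<Longrightarrow> polyfun (\<lambda>z. f z - g z)"
  and polyfun_uminus: "polyfun f \<Longrightarrow> polyfun (\<lambda>z. - f z)"
  and polyfun_mult: "polyfun f \<Longrightarrow> polyfun g \<Longrightarrow> polyfun (\<lambda>z. f z * g z)"
  and polyfun_divide: "polyfun f \<Longrightarrow> polyfun (\<lambda>z. f z / c)"
  unfolding polyfun_def
  by (blast, metis poly_const_conv, metis poly_add, metis poly_diff, metis poly_minus, metis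
      poly_mult,
      metis divide_inverse mult.commute poly_smult)

lemma polyfun_sum: "(\<And>i. i \<in> A \<Longrightarrow> polyfun (f i)) \<Longrightarrow> polyfun (\<lambda>z. \<Sum>i\<in>A. f i z)"
  by (induction A rule: infinite_finite_induct) (auto intro: polyfun_add)

lemma polyfun_isCont: "polyfun f \<Longrightarrow> isCont f z"
proof -
  assume "polyfun f"
  then obtain p where "f = poly p" by (auto simp: polyfun_def)
  then show ?thesis by simp
qed

lemma polyfun_zero_factor:
  assumes "polyfun f" "f 0 = 0"
  shows "\<exists>q. \<forall>z. f z = z * poly q z"
proof -
  obtain p where p: "\<And>z. f z = poly p z" using assms(1) by (auto simp: polyfun_def)
  with assms(2) have "poly p 0 = 0" by simp
  then obtain q where "p = [:0, 1:] * q" by (metis dvdE minus_zero poly_eq_0_iff_dvd)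
  with p show ?thesis by auto
qed

definition polyfps :: "(complex \<Rightarrow> complex fps) \<Rightarrow> bool" where
  "polyfps F \<longleftrightarrow> (\<forall>n. polyfun (\<lambda>z. F z $ n))"

lemma polyfps_mult: "polyfps F \<Longrightarrow> polyfps G \<Longrightarrow> polyfps (\<lambda>z. F z * G z)"
  unfolding polyfps_def fps_mult_nth by (intro allI polyfun_sum polyfun_mult) auto

lemma polyfps_const: "polyfps (\<lambda>_. F)"
  by (simp add: polyfps_def)

lemma polyfps_power: "polyfps F \<Longrightarrow> polyfps (\<lambda>z. F z ^ n)"
  by (induction n) (simp_all add: polyfps_const polyfps_mult)

lemma polyfps_sum: "(\<And>i. i \<in> A \<Longrightarrow> polyfps (F i)) \<Longrightarrow> polyfps (\<lambda>z. \<Sum>i\<in>A. F i z)"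
  unfolding polyfps_def fps_sum_nth by (intro allI polyfun_sum) auto

text \<open>As the constant term is 1, the recursion for the coefficients of the inverse involves no
  division and stays among polynomials in z.\<close>

lemma polyfps_inverse:
  assumes F: "polyfps F" and F0: "\<And>z. F z $ 0 = 1"
  shows "polyfps (\<lambda>z. inverse (F z))"
  unfolding polyfps_def
proof
  fix n show "polyfun (\<lambda>z. inverse (F z) $ n)"
  proof (induction n rule: less_induct)
    case (less n)
    show ?case
    proof (cases "n = 0")
      case True
      then show ?thesis by (simp add: F0)
    next
      case False
      have "inverse (F z) $ n = - (\<Sum>i=1..n. F z $ i * inverse (F z) $ (n - i))" for z
      proof -
        have "(F z * inverse (F z)) $ n = 0"
          using False F0[of z] by (simp add: inverse_mult_eq_1')
        then have "inverse (F z) $ n + (\<Sum>i=1..n. F z $ i * inverse (F z) $ (n - i)) = 0"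
          unfolding fps_mult_nth by (subst (asm) sum.atLeast_Suc_atMost) (auto simp: F0)
        then show ?thesis by (simp add: eq_neg_iff_add_eq_0)
      qed
      moreover have "polyfun (\<lambda>z. - (\<Sum>i=1..n. F z $ i * inverse (F z) $ (n - i)))"
        using F by (intro polyfun_uminus polyfun_sum polyfun_mult less.IH) (auto simp: polyfps_def)
      ultimately show ?thesis by (simp cong del: if_weak_cong)
    qed
  qed
qed

lemma polyfps_base: "polyfps (\<lambda>z. base_fps e (\<lambda>i. poly (X i) z))"
  unfolding polyfps_def
proof
  show "polyfun (\<lambda>z. base_fps e (\<lambda>i. poly (X i) z) $ n)" for n
    by (cases "n = 0"; cases "n \<le> e") (simp_all add: base_fps_nth)
qed

lemma polyfun_g_val: "polyfun (\<lambda>z. g_val e k (\<lambda>i. poly (X i) z))"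
proof -
  have "polyfps (\<lambda>z. inverse (base_fps e (\<lambda>i. poly (X i) z)) ^ Suc k)"
    by (intro polyfps_power polyfps_inverse polyfps_base) (simp add: base_fps_nth)
  then show ?thesis unfolding g_val_def polyfps_def by (intro polyfun_divide) (rule spec)
qed

text \<open>An exact difference formula in place of a Taylor expansion: 1/P' - 1/P = - z^m V / (P
  P'), where V collects the v_i, and the difference of the (k+1)st powers factors accordingly. At z
  = 0 the series P and P' agree, and - E(0) is the derivative of g_k in direction v.\<close>

lemma g_val_perturb:
  fixes X :: "nat \<Rightarrow> complex poly" and v :: "nat \<Rightarrow> complex"
  assumes "m \<ge> 1" "k \<ge> 1"
  shows "\<exists>E. (\<forall>z. g_val e k (\<lambda>i. poly (X i + monom (v i) m) z)
      = g_val e k (\<lambda>i. poly (X i) z) - z ^ m * poly E z)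
    \<and> poly E 0 = (\<Sum>i<e. v (Suc i) * alpha_val e i (k - 1) (\<lambda>i. poly (X i) 0))"
proof -
  define P where "P z = base_fps e (\<lambda>i. poly (X i) z)" for z
  define P' where "P' z = base_fps e (\<lambda>i. poly (X i + monom (v i) m) z)" for z
  define V where "V = Abs_fps (\<lambda>i. if i = 0 then 0 else if i \<le> e then v i else 0)"
  let ?I = "\<lambda>z. inverse (P z)" and ?I' = "\<lambda>z. inverse (P' z)"
  have P0: "P z $ 0 = 1" "P' z $ 0 = 1" for z by (simp_all add: P_def P'_def base_fps_nth)
  then have inv: "?I z * P z = 1" "P' z * ?I' z = 1" for z
    by (simp_all add: inverse_mult_eq_1 inverse_mult_eq_1')
  have P': "P' z = P z + fps_const (z ^ m) * V" for z
    by (rule fps_ext) (simp add: P_def P'_def V_def base_fps_nth poly_monom mult.commute)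
  have Idiff: "?I' z - ?I z = - (fps_const (z ^ m) * (V * (?I z * ?I' z)))" for z
  proof -
    have "?I' z - ?I z = (?I z * P z) * ?I' z - ?I z * (P' z * ?I' z)" by (simp add: inv)
    also have "\<dots> = - (fps_const (z ^ m) * (V * (?I z * ?I' z)))" unfolding P'
        by (simp add: algebra_simps)
    finally show ?thesis .
  qed
  define F where "F z = V * (?I z * ?I' z) * (\<Sum>i<Suc k. ?I z ^ (Suc k - Suc i) * ?I' z ^ i)" for z
  have "?I' z ^ Suc k - ?I z ^ Suc k = - (fps_const (z ^ m) * F z)" for z
    unfolding power_diff_sumr2 Idiff F_def by (simp only: mult_minus_left mult.assoc)
  then have "(?I' z ^ Suc k) $ k = (?I z ^ Suc k) $ k - z ^ m * F z $ k" for z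
    by (metis (no_types) fps_sub_nth fps_neg_nth fps_mult_left_const_nth add.commute
        add_uminus_conv_diff diff_add_cancel)
  then have g: "g_val e k (\<lambda>i. poly (X i + monom (v i) m) z)
      = g_val e k (\<lambda>i. poly (X i) z) - z ^ m * (F z $ k / of_nat (Suc k))" for z
    unfolding g_val_def P_def[symmetric] P'_def[symmetric] by (simp add: diff_divide_distrib)
  have "polyfps ?I" "polyfps ?I'"
    unfolding P_def P'_def by (intro polyfps_inverse polyfps_base; simp add: base_fps_nth)+
  then have "polyfps F" unfolding F_def
    by (intro polyfps_mult polyfps_sum polyfps_power polyfps_const)
  then have "polyfun (\<lambda>z. F z $ k / of_nat (Suc k))"
      by (intro polyfun_divide) (simp add: polyfps_def)
  then obtain E where E: "\<And>z. F z $ k / of_nat (Suc k) = poly E z" by (auto simp: polyfun_def)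
  have "P' 0 = P 0" using assms(1) by (simp add: P' power_0_left)
  then have "F 0 = V * (?I 0 * ?I 0) * (\<Sum>i<Suc k. ?I 0 ^ k)"
    unfolding F_def by (intro arg_cong2[of _ _ _ _ "(*)"] sum.cong refl) (auto
        simp: power_add[symmetric])
  also have "\<dots> = of_nat (Suc k) * (V * ?I 0 ^ (k + 2))"
    by (simp add: power_add power2_eq_square algebra_simps del: of_nat_Suc)
  finally have "F 0 $ k = of_nat (Suc k) * (V * ?I 0 ^ (k + 2)) $ k"
    by (simp only: fps_of_nat[symmetric] fps_mult_left_const_nth)
  then have "poly E 0 = (V * ?I 0 ^ (k + 2)) $ k"
    unfolding E[symmetric] by (simp only: nonzero_mult_div_cancel_left of_nat_neq_0
        not_False_eq_True)
  also have "\<dots> = (\<Sum>i=0..k. V $ i * (?I 0 ^ (k + 2)) $ (k - i))" by (rule fps_mult_nth)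
  also have "\<dots> = (\<Sum>i\<in>{1..k} \<inter> {1..e}. v i * (?I 0 ^ (k + 2)) $ (k - i))"
    by (rule sum.mono_neutral_cong_right) (auto simp: V_def)
  also have "\<dots> = (\<Sum>i=1..e. v i * alpha_val e (i - 1) (k - 1) (\<lambda>i. poly (X i) 0))"
  proof (rule sum.mono_neutral_cong_left)
    fix i assume i: "i \<in> {1..k} \<inter> {1..e}"
    then have "k - 1 - (i - 1) = k - i" "k - 1 + 3 = k + 2" "i - 1 \<le> k - 1" using assms(2) by auto
    then show "v i * (?I 0 ^ (k + 2)) $ (k - i)
        = v i * alpha_val e (i - 1) (k - 1) (\<lambda>i. poly (X i) 0)"
      by (simp only: alpha_val_def P_def if_True)
  qed (use assms(2) in \<open>auto simp: alpha_val_def\<close>)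
  also have "\<dots> = (\<Sum>i<e. v (Suc i) * alpha_val e i (k - 1) (\<lambda>i. poly (X i) 0))"
    by (rule sum.reindex_bij_witness[of _ Suc "\<lambda>i. i - 1"]) auto
  finally show ?thesis using g unfolding E by blast
qed

section \<open>Newton iteration along the curve\<close>

text \<open>The unknown vector stands on the left, because the rows of the \<alpha>-matrix belong to
  the variables and its columns to the equations; hence a left inverse is used.\<close>

lemma det_nonzero_solve:
  fixes A :: "nat \<Rightarrow> nat \<Rightarrow> 'a::field"
  assumes "det (mat n n (\<lambda>(i, k). A i k)) \<noteq> 0"
  obtains v where "\<And>k. k < n \<Longrightarrow> (\<Sum>i<n. v i * A i k) = b k"
proof -
  let ?A = "mat n n (\<lambda>(i, k). A i k)"
  have A: "?A \<in> carrier_mat n n" by simp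
  from det_non_zero_imp_unit[OF A assms] obtain B where
    B: "B \<in> carrier_mat n n" "B * ?A = 1\<^sub>m n"
    unfolding Units_def by (auto simp: ring_mat_simps)
  have "(\<Sum>i<n. (\<Sum>j<n. b j * B $$ (j, i)) * A i k) = b k" if k: "k < n" for k
  proof -
    have "(\<Sum>i<n. (\<Sum>j<n. b j * B $$ (j, i)) * A i k) = (\<Sum>j<n. b j * (\<Sum>i<n. B $$ (j, i) * A i k))"
      by (simp only: sum_distrib_left sum_distrib_right mult.assoc) (rule sum.swap)
    also have "\<dots> = (\<Sum>j<n. b j * (if j = k then 1 else 0))"
    proof (intro sum.cong refl arg_cong2[of _ _ _ _ "(*)"])
      fix j assume j: "j \<in> {..<n}"
      have "(B * ?A) $$ (j, k) = (\<Sum>i<n. B $$ (j, i) * A i k)"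
        using B(1) j k by (simp add: scalar_prod_def atLeast0LessThan)
      then show "(\<Sum>i<n. B $$ (j, i) * A i k) = (if j = k then 1 else 0)"
        using B(2) j k by simp
    qed
    also have "\<dots> = b k" using k by (simp add: if_distrib[of "(*) _"] cong: if_cong)
    finally show ?thesis .
  qed
  then show ?thesis by (rule that)
qed

text \<open>Newton iteration: the Jacobian matrix of \<open>(g_d, \<dots>, g_{d+e-1})\<close> is, up to sign, the matrix of
  the \<open>\<alpha>\<close>'s.\<close>

lemma hensel_lift:
  fixes x0 :: "nat \<Rightarrow> complex" and T :: "nat \<Rightarrow> complex poly"
  assumes d: "d \<ge> 1" and det: "det (mat e e (\<lambda>(i, k). alpha_val e i (d - 1 + k) x0)) \<noteq> 0"
    and T: "\<And>k. k < e \<Longrightarrow> poly (T k) 0 = g_val e (d + k) x0"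
  shows "\<exists>X. (\<forall>i. poly (X i) 0 = x0 i) \<and> (\<forall>k<e. \<exists>r. \<forall>z.
    poly (T k) z - g_val e (d + k) (\<lambda>i. poly (X i) z) = z ^ Suc m * poly r z)"
proof (induction m)
  case 0
  let ?X = "\<lambda>i. [:x0 i:]"
  have "\<exists>r. \<forall>z. poly (T k) z - g_val e (d + k) (\<lambda>i. poly (?X i) z) = z ^ Suc 0 * poly r z" if
      "k < e" for k
    using polyfun_zero_factor[OF polyfun_diff[OF polyfun_poly[of "T k"] polyfun_g_val[of e "d
        + k" ?X]]]
      T[OF that] by simp
  then show ?case by (intro exI[of _ ?X]) simp
next
  case (Suc m)
  then obtain X where X0: "\<And>i. poly (X i) 0 = x0 i" and
    "\<forall>k<e. \<exists>r. \<forall>z. poly (T k) z - g_val e (d + k) (\<lambda>i. poly (X i) z)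
        = z ^ Suc m * poly r z" by blast
  then obtain r where r: "\<And>k z. k < e \<Longrightarrow>
      poly (T k) z - g_val e (d + k) (\<lambda>i. poly (X i) z) = z ^ Suc m * poly (r k) z" by metis
  \<comment> \<open>Adding w z^(m+1) to the curve changes the quotient r_k of the error into r_k +
    E. The choice of w makes this vanish at 0, which gains one more factor z. Rows are numbered from
    0 and variables from 1, hence the shift in v.\<close>
  obtain w where w: "\<And>k. k < e \<Longrightarrow> (\<Sum>i<e. w i * alpha_val e i (d - 1 + k) x0) = - poly (r k) 0"
    using det_nonzero_solve[OF det, of "\<lambda>k. - poly (r k) 0"] by metis
  define v where "v i = w (i - 1)" for i
  let ?X = "\<lambda>i. X i + monom (v i) (Suc m)"
  have "\<exists>s. \<forall>z. poly (T k) z - g_val e (d + k) (\<lambda>i. poly (?X i) z) = z ^ Suc (Suc m) * poly s z"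
    if k: "k < e" for k
  proof -
    have "d + k \<ge> 1" using d by simp
    from g_val_perturb[OF _ this, of "Suc m" e X v] obtain E where
      E: "\<And>z. g_val e (d + k) (\<lambda>i. poly (?X i) z) = g_val e (d
          + k) (\<lambda>i. poly (X i) z) - z ^ Suc m * poly E z"
      "poly E 0 = (\<Sum>i<e. v (Suc i) * alpha_val e i (d + k - 1) (\<lambda>i. poly (X i) 0))" by auto
    have "d + k - 1 = d - 1 + k" using d by simp
    with E(2) w[OF k] have "poly (r k + E) 0 = 0" by (simp add: X0 v_def)
    then obtain s where s: "r k + E = [:0, 1:] * s" by (metis dvdE minus_zero poly_eq_0_iff_dvd)
    have "poly (T k) z - g_val e (d + k) (\<lambda>i. poly (?X i) z) = z ^ Suc m * poly (r k + E) z" for z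
      unfolding E(1) using r[OF k, of z] by (simp add: algebra_simps)
    then show ?thesis unfolding s by (intro exI[of _ s]) simp
  qed
  moreover have "poly (?X i) 0 = x0 i" for i by (simp add: X0 poly_monom)
  ultimately show ?case by (intro exI[of _ ?X]) blast
qed

lemma tendsto_power_mult_0:
  assumes "polyfun f" "n \<ge> 1"
  shows "((\<lambda>z. z ^ n * f z) \<longlongrightarrow> 0) (at 0)"
proof -
  have "(f \<longlongrightarrow> f 0) (at 0)" using polyfun_isCont[OF assms(1)] by (rule isContD)
  then have "((\<lambda>z. z ^ n * f z) \<longlongrightarrow> 0 ^ n * f 0) (at 0)"
    by (intro tendsto_mult tendsto_power tendsto_ident_at)
  then show ?thesis using assms(2) by (simp add: power_0_left)
qed

text \<open>\<gamma> is fixed before c, because \<open>approximate_factorization\<close> computes c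
  from a scaling that depends on \<gamma>.\<close>

lemma PIC_curve:
  assumes "d \<ge> 2" "e \<ge> 1" "PIC d e"
  obtains \<gamma> :: complex where "\<gamma> \<noteq> 0"
    "\<And>c :: nat \<Rightarrow> complex. \<exists>y. (\<forall>i\<ge>1. ((\<lambda>z. y z i) \<longlongrightarrow> 0) (at 0))
      \<and> (\<forall>\<^sub>F z in at 0. y z e \<noteq> 0)
      \<and> (\<forall>k\<ge>1. ((\<lambda>z. g_val e k (y z)) \<longlongrightarrow> 0) (at 0))
      \<and> (\<forall>k\<ge>d. ((\<lambda>z. g_val e k (y z) / z ^ (d + e - 1)) \<longlongrightarrow>
          (if k < d + e - 1 then c k else if k = d + e - 1 then \<gamma> else 0)) (at 0))"
proof -
  obtain x0 :: "nat \<Rightarrow> complex" where x0: "\<And>k. d \<le> k \<Longrightarrow> k < d + e - 1 \<Longrightarrow> g_val e k x0 = 0"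
    "g_val e (d + e - 1) x0 \<noteq> 0" "det (mat e e (\<lambda>(i, k). alpha_val e i (d - 1 + k) x0)) \<noteq> 0"
    by (rule PIC_point[OF assms], rule that)
  define \<gamma> where "\<gamma> = g_val e (d + e - 1) x0"
  have "\<exists>y. (\<forall>i\<ge>1. ((\<lambda>z. y z i) \<longlongrightarrow> 0) (at 0)) \<and> (\<forall>\<^sub>F z in at 0. y z e \<noteq> 0)
      \<and> (\<forall>k\<ge>1. ((\<lambda>z. g_val e k (y z)) \<longlongrightarrow> 0) (at 0))
      \<and> (\<forall>k\<ge>d. ((\<lambda>z. g_val e k (y z) / z ^ (d + e - 1)) \<longlongrightarrow>
          (if k < d + e - 1 then c k else if k = d + e - 1 then \<gamma> else 0)) (at 0))"
    for c :: "nat \<Rightarrow> complex"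
  proof -
    \<comment> \<open>The scaling will contribute z^(d+k), so the exponent e-1-k completes it to
      z^(d+e-1). For k < e-1 the target vanishes at 0, as g_(d+k) does at \<open>x0\<close>; for k =
      e-1 it is the constant value there.\<close>
    define T where "T k = (if k = e - 1 then [:\<gamma>:] else monom (c (d + k)) (e - 1 - k))" for k
    have T0: "poly (T k) 0 = g_val e (d + k) x0" if "k < e" for k
      using x0(1)[of "d + k"] that by (auto simp: T_def \<gamma>_def poly_monom power_0_left)
    have "d \<ge> 1" "Suc (e - 1) = e" using assms(1,2) by auto
    with hensel_lift[OF _ x0(3) T0, of "e - 1"] obtain X where "\<forall>k<e. \<exists>r. \<forall>z.
        poly (T k) z - g_val e (d + k) (\<lambda>i. poly (X i) z) = z ^ e * poly r z" by auto
    then obtain r where r: "\<And>k z. k < e \<Longrightarrow>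
        poly (T k) z - g_val e (d + k) (\<lambda>i. poly (X i) z) = z ^ e * poly (r k) z" by metis
    \<comment> \<open>The Newton solution may have X_e = 0, which would lower the degree of f. In
      that case z^e is added; all congruences hold modulo z^e and survive.\<close>
    define v where "v i = (if i = e \<and> X e = 0 then 1 else 0 :: complex)" for i
    define X' where "X' i = X i + monom (v i) e" for i
    have X'e: "X' e \<noteq> 0" by (auto simp: X'_def v_def)
    have "\<exists>s. \<forall>z. g_val e (d + k) (\<lambda>i. poly (X' i) z) = poly (T k) z - z ^ e * poly s z" if k:
        "k < e" for k
    proof -
      have "d + k \<ge> 1" using assms(1) by simp
      from g_val_perturb[OF assms(2) this, of e X v] obtain E where
        E: "\<And>z. g_val e (d + k) (\<lambda>i. poly (X' i) z) = g_val e (d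
            + k) (\<lambda>i. poly (X i) z) - z ^ e * poly E z"
        unfolding X'_def by blast
      show ?thesis unfolding E
        by (intro exI[of _ "r k + E"] allI) (use r[OF k] in \<open>simp add: algebra_simps\<close>)
    qed
    then obtain s where s: "\<And>k z. k < e \<Longrightarrow>
        g_val e (d + k) (\<lambda>i. poly (X' i) z) = poly (T k) z - z ^ e * poly (s k) z" by metis
    define y where "y z i = z ^ i * poly (X' i) z" for z i
    have gy: "g_val e k (y z) = z ^ k * g_val e k (\<lambda>i. poly (X' i) z)" for k z
      unfolding y_def by (rule g_val_scale)
    have "((\<lambda>z. y z i) \<longlongrightarrow> 0) (at 0)" if "i \<ge> 1" for i
      unfolding y_def using that by (intro tendsto_power_mult_0) auto
    moreover have "\<forall>\<^sub>F z in at 0. y z e \<noteq> 0"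
    proof -
      have "finite {z. poly (X' e) z = 0}" using X'e by (rule poly_roots_finite)
      then have "open (- ({z. poly (X' e) z = 0} - {0}))"
        by (intro open_Compl finite_imp_closed) simp
      then show ?thesis unfolding eventually_at_topological
        by (intro exI[of _ "- ({z. poly (X' e) z = 0} - {0})"]) (auto simp: y_def)
    qed
    moreover have "((\<lambda>z. g_val e k (y z)) \<longlongrightarrow> 0) (at 0)" if "k \<ge> 1" for k
      unfolding gy using that by (intro tendsto_power_mult_0 polyfun_g_val)
    moreover have "((\<lambda>z. g_val e k (y z) / z ^ (d + e - 1)) \<longlongrightarrow>
          (if k < d + e - 1 then c k else if k = d + e - 1 then \<gamma> else 0)) (at 0)" if k: "k \<ge> d"
              for k
    proof (cases "k < d + e")
      case True
      define j where "j = k - d"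
      then have j: "j < e" "k = d + j" using k True by auto
      let ?L = "if k < d + e - 1 then c k else \<gamma>"
      have T: "poly (T j) z = z ^ (e - 1 - j) * ?L" for z
        using j by (auto simp: T_def poly_monom)
      \<comment> \<open>The error z^e exceeds the order e-1-j of the target by j+1 \<ge> 1, so it
        disappears in the limit.\<close>
      have "g_val e k (y z) / z ^ (d + e - 1) = ?L - z ^ Suc j * poly (s j) z" if "z \<noteq> 0" for z
      proof -
        have p1: "z ^ (d + e - 1) = z ^ k * z ^ (e - 1 - j)" using j
            by (simp add: power_add[symmetric])
        have p2: "z ^ e = z ^ (e - 1 - j) * z ^ Suc j"
          using j unfolding power_add[symmetric] by (intro arg_cong[of _ _ "power z"]) simp
        have "g_val e k (y z) = z ^ k * z ^ (e - 1 - j) * (?L - z ^ Suc j * poly (s j) z)"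
          unfolding gy unfolding j(2) s[OF j(1)] T p2 unfolding j(2)[symmetric]
              by (simp only: right_diff_distrib mult.assoc)
        then show ?thesis unfolding p1 using that by (simp del: power_Suc)
      qed
      then have "\<forall>\<^sub>F z in at 0. ?L - z ^ Suc j * poly (s j) z = g_val e k (y z) / z ^ (d + e - 1)"
        by (simp add: eventually_at_filter)
      moreover have "((\<lambda>z. ?L - z ^ Suc j * poly (s j) z) \<longlongrightarrow> ?L - 0) (at 0)"
        using tendsto_power_mult_0[OF polyfun_poly, of "Suc j" "s j"] by (intro tendsto_intros) simp
      ultimately have "((\<lambda>z. g_val e k (y z) / z ^ (d + e - 1)) \<longlongrightarrow> ?L - 0) (at 0)"
        by (rule Lim_transform_eventually[rotated])
      then show ?thesis using True by (auto split: if_splits)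
    next
      case False
      let ?g = "\<lambda>z. g_val e k (\<lambda>i. poly (X' i) z)"
      \<comment> \<open>For k \<ge> d+e the weight alone leaves a positive power of z.\<close>
      have "g_val e k (y z) / z ^ (d + e - 1) = z ^ (k - (d + e - 1)) * ?g z" if "z \<noteq> 0" for z
        using that False by (simp add: gy power_diff)
      then have "\<forall>\<^sub>F z in at 0. z ^ (k - (d + e - 1)) * ?g z = g_val e k (y z) / z ^ (d + e - 1)"
        by (simp add: eventually_at_filter)
      moreover have "((\<lambda>z. z ^ (k - (d + e - 1)) * ?g z) \<longlongrightarrow> 0) (at 0)"
        using False assms(2) by (intro tendsto_power_mult_0 polyfun_g_val) auto
      ultimately have "((\<lambda>z. g_val e k (y z) / z ^ (d + e - 1)) \<longlongrightarrow> 0) (at 0)"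
        by (rule Lim_transform_eventually[rotated])
      then show ?thesis using False assms(2) by auto
    qed
    ultimately show ?thesis by (intro exI[of _ y]) blast
  qed
  then show ?thesis using that x0(2) unfolding \<gamma>_def by blast
qed

section \<open>Degenerations of plane automorphisms\<close>

abbreviation xyC :: "complex \<Rightarrow> xypoly" where "xyC c \<equiv> [:[:c:]:]"
abbreviation xyX :: xypoly where "xyX \<equiv> [:0, 1:]"
abbreviation xyY :: xypoly where "xyY \<equiv> [:[:0, 1:]:]"

lemma comm_ring_hom_xyC: "comm_ring_hom xyC"
  by unfold_locales (simp_all add: one_pCons)

text \<open>The constants, X and Y generate the ring, so laws of substitution need checking only
  there.\<close>

lemma xypoly_induct [case_names const X Y add mult]:
  fixes Q :: "xypoly \<Rightarrow> bool"
  assumes const: "\<And>c. Q (xyC c)" and X: "Q xyX" and Y: "Q xyY"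
    and add: "\<And>A B. Q A \<Longrightarrow> Q B \<Longrightarrow> Q (A + B)" and mult: "\<And>A B. Q A \<Longrightarrow> Q B \<Longrightarrow> Q (A * B)"
  shows "Q P"
proof -
  have const': "Q [:p:]" for p
  proof (induction p)
    case 0
    then show ?case using const[of 0] by simp
  next
    case (pCons a p)
    have "[:pCons a p:] = xyC a + xyY * [:p:]" by simp
    then show ?case using add[OF const mult[OF Y pCons(2)]] by metis
  qed
  show ?thesis
  proof (induction P)
    case 0
    then show ?case using const[of 0] by simp
  next
    case (pCons p P)
    have "pCons p P = [:p:] + xyX * P" by simp
    then show ?case using add[OF const' mult[OF X pCons(2)]] by metis
  qed
qed

lemma comm_ring_hom_eval:
  assumes "comm_ring_hom h"
  shows "comm_ring_hom (\<lambda>p. poly (map_poly h p) x)"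
proof -
  interpret comm_ring_hom h by fact
  interpret P: map_poly_comm_ring_hom h ..
  show ?thesis by unfold_locales (simp_all add: P.hom_mult P.hom_add)
qed

lemma comm_ring_hom_xy_subst: "comm_ring_hom (\<lambda>P. xy_subst P F)"
  unfolding xy_subst_def by (intro comm_ring_hom_eval comm_ring_hom_xyC)

lemma map_poly_const: "f 0 = 0 \<Longrightarrow> map_poly f [:p:] = [:f p:]"
  by (cases "p = 0") (simp_all add: map_poly_pCons)

lemma xy_subst_simps:
  shows xy_subst_add: "xy_subst (P + Q) F = xy_subst P F + xy_subst Q F"
    and xy_subst_mult: "xy_subst (P * Q) F = xy_subst P F * xy_subst Q F"
    and xy_subst_const: "xy_subst (xyC c) F = xyC c"
    and xy_subst_X: "xy_subst xyX F = fst F"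
    and xy_subst_Y: "xy_subst xyY F = snd F"
proof -
  interpret comm_ring_hom "\<lambda>P. xy_subst P F" by (rule comm_ring_hom_xy_subst)
  show "xy_subst (P + Q) F = xy_subst P F + xy_subst Q F" "xy_subst (P * Q) F
      = xy_subst P F * xy_subst Q F"
    by (rule hom_add hom_mult)+
  show "xy_subst (xyC c) F = xyC c" "xy_subst xyX F = fst F" "xy_subst xyY F = snd F"
    by (simp_all add: xy_subst_def map_poly_pCons map_poly_const flip: one_pCons)
qed

lemma xy_subst_pCons: "xy_subst [:p:] F = poly (map_poly xyC p) (snd F)"
  by (simp add: xy_subst_def map_poly_const)

lemma xy_subst_monom: "xy_subst (monom (monom c j) i) F = xyC c * snd F ^ j * fst F ^ i"
  by (simp add: xy_subst_def map_poly_monom poly_monom)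

lemma xy_subst_tri1: "xy_subst [:P, [:a:]:] F = poly (map_poly xyC P) (snd F) + xyC a * fst F"
proof -
  have "[:P, [:a:]:] = [:P:] + xyC a * xyX" by simp
  then show ?thesis by (simp only: xy_subst_add xy_subst_mult xy_subst_X xy_subst_pCons)
      (simp add: map_poly_const)
qed

lemma xy_subst_tri2: "xy_subst [:[:c, b:]:] F = xyC c + xyC b * snd F"
proof -
  have "[:[:c, b:]:] = xyC c + xyC b * xyY" by simp
  then show ?thesis by (simp only: xy_subst_add xy_subst_mult xy_subst_const xy_subst_Y)
qed

lemma pmap_comp_simps [simp]:
  "fst (F \<odot> G) = xy_subst (fst F) G" "snd (F \<odot> G) = xy_subst (snd F) G"
  by (simp_all add: pmap_comp_def)

lemma xy_subst_comp: "xy_subst (xy_subst P F) G = xy_subst P (F \<odot> G)"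
  by (induction P rule: xypoly_induct) (simp_all only: xy_subst_simps pmap_comp_simps)

lemma pmap_comp_assoc: "F \<odot> G \<odot> H = F \<odot> (G \<odot> H)"
  by (simp add: prod_eq_iff xy_subst_comp)

lemma pmap_comp_id [simp]: "F \<odot> pmap_id = F" "pmap_id \<odot> F = F"
proof -
  have "xy_subst P pmap_id = P" for P
    by (induction P rule: xypoly_induct) (simp_all only: xy_subst_simps pmap_id_def fst_conv
        snd_conv)
  then show "F \<odot> pmap_id = F" by (simp add: prod_eq_iff)
  show "pmap_id \<odot> F = F" by (simp add: prod_eq_iff pmap_id_def xy_subst_X xy_subst_Y)
qed

lemma GA_comp:
  assumes "F \<in> GA" "G \<in> GA"
  shows "F \<odot> G \<in> GA"
proof -
  from assms obtain F' G' where "F \<odot> F' = pmap_id" "F' \<odot> F = pmap_id" "G \<odot> G' = pmap_id" "G' \<odot> G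
      = pmap_id"
    by (auto simp: GA_def)
  then have "F \<odot> G \<odot> (G' \<odot> F') = pmap_id" "(G' \<odot> F') \<odot> (F \<odot> G) = pmap_id"
    by (metis pmap_comp_assoc pmap_comp_id(2))+
  then show ?thesis unfolding GA_def by blast
qed

lemma map_poly_xyC_pcompose: "poly (map_poly xyC P) [:L:] = [:pcompose P L:]"
  by (induction P) (simp_all add: map_poly_pCons pcompose_pCons)

lemma Tri_subset_GA: "Tri \<subseteq> GA"
proof
  fix T assume "T \<in> Tri"
  then obtain a b c P where T: "T = ([:P, [:a:]:], [:[:c, b:]:])" and ab: "a \<noteq> 0" "b \<noteq> 0"
    by (auto simp: Tri_def)
  have ev: "xy_subst [:Q, [:u:]:] ([:R, [:u':]:], [:L:]) = [:pcompose Q L + smult u R, [:u * u':]:]"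
    "xy_subst [:[:v, w:]:] (A, [:L:]) = [:[:v:] + smult w L:]" for Q u R u' L v w A
    by (simp_all add: xy_subst_tri1 xy_subst_tri2 map_poly_xyC_pcompose)
  let ?L = "[:- c / b, 1 / b:]"
  let ?S = "([:smult (- 1 / a) (pcompose P ?L), [:1 / a:]:], [:?L:])"
  have comp: "pcompose ?L [:c, b:] = [:0, 1:]" "pcompose [:c, b:] ?L = [:0, 1:]"
    using ab by (simp_all add: pcompose_pCons)
  have PL: "pcompose (pcompose P ?L) [:c, b:] = P"
    using comp(1) by (metis pcompose_assoc pcompose_idR)
  have "T \<odot> ?S = pmap_id"
    unfolding T pmap_comp_def fst_conv snd_conv ev pmap_id_def using ab by simp
  moreover have "?S \<odot> T = pmap_id"
    unfolding T pmap_comp_def fst_conv snd_conv ev pmap_id_def pcompose_smult PL using ab by simp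
  ultimately show "T \<in> GA" unfolding GA_def by blast
qed

section \<open>Total degree\<close>

text \<open>\<open>xy_degree\<close> as an upper bound: this form passes through sums, products and
  limits without treating \<open>Max\<close> or the zero polynomial separately.\<close>

definition deg_le :: "nat \<Rightarrow> xypoly \<Rightarrow> bool" where
  "deg_le n P \<longleftrightarrow> (\<forall>i j. coeff (coeff P i) j \<noteq> 0 \<longrightarrow> i + j \<le> n)"

lemma xy_degree_le_iff: "xy_degree P \<le> n \<longleftrightarrow> deg_le n P"
proof -
  let ?S = "{i + j | i j. coeff (coeff P i) j \<noteq> 0}"
  have "?S \<subseteq> (\<lambda>(i, j). i + j) ` ({..degree P} \<times> (\<Union>i\<le>degree P. {..degree (coeff P i)}))"
  proof
    fix n assume "n \<in> ?S"
    then obtain i j where ij: "n = i + j" "coeff (coeff P i) j \<noteq> 0" by blast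
    then have "coeff P i \<noteq> 0" by auto
    with ij show "n \<in> (\<lambda>(i, j). i + j) ` ({..degree P} \<times> (\<Union>i\<le>degree P. {..degree (coeff P i)}))"
      by (intro image_eqI[of _ _ "(i, j)"]) (auto intro: le_degree)
  qed
  then have "finite ?S" by (rule finite_subset) auto
  then have "xy_degree P \<le> n \<longleftrightarrow> (\<forall>s\<in>insert 0 ?S. s \<le> n)"
    unfolding xy_degree_def by (subst Max_le_iff) auto
  then show ?thesis by (auto simp: deg_le_def)
qed

lemma pmap_degree_le_iff: "pmap_degree F \<le> n \<longleftrightarrow> deg_le n (fst F) \<and> deg_le n (snd F)"
  by (simp add: pmap_degree_def xy_degree_le_iff)

lemma deg_le_mono: "deg_le m P \<Longrightarrow> m \<le> n \<Longrightarrow> deg_le n P"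
  unfolding deg_le_def by (meson order_trans)

lemma deg_le_add: "deg_le n P \<Longrightarrow> deg_le n Q \<Longrightarrow> deg_le n (P + Q)"
  unfolding deg_le_def coeff_add by (metis add.right_neutral)

lemma deg_le_const: "deg_le n (xyC c)"
  by (auto simp: deg_le_def coeff_pCons split: nat.splits)

lemma deg_le_sum: "(\<And>i. i \<in> A \<Longrightarrow> deg_le n (f i)) \<Longrightarrow> deg_le n (sum f A)"
proof (induction A rule: infinite_finite_induct)
  case (insert x F)
  then show ?case by (auto intro: deg_le_add)
qed (auto simp: deg_le_def)

lemma deg_le_mult:
  assumes "deg_le m P" "deg_le n Q"
  shows "deg_le (m + n) (P * Q)"
  unfolding deg_le_def
proof (intro allI impI)
  fix i j assume "coeff (coeff (P * Q) i) j \<noteq> 0"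
  then have "(\<Sum>k\<le>i. \<Sum>l\<le>j. coeff (coeff P k) l * coeff (coeff Q (i - k)) (j - l)) \<noteq> 0"
    by (simp add: coeff_mult coeff_sum)
  then obtain k l where "k \<le> i" "l \<le> j" "coeff (coeff P k) l \<noteq> 0"
      "coeff (coeff Q (i - k)) (j - l) \<noteq> 0"
    by (metis (no_types, lifting) atMost_iff mult_eq_0_iff sum.neutral)
  with assms have "k + l \<le> m" "(i - k) + (j - l) \<le> n" unfolding deg_le_def by blast+
  with \<open>k \<le> i\<close> \<open>l \<le> j\<close> show "i + j \<le> m + n" by linarith
qed

lemma deg_le_power: "deg_le n P \<Longrightarrow> deg_le (k * n) (P ^ k)"
  by (induction k) (auto intro: deg_le_mult simp: one_pCons deg_le_const)

lemma xypoly_expand: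
  assumes "deg_le N P"
  shows "P = (\<Sum>i\<le>N. \<Sum>j\<le>N. monom (monom (coeff (coeff P i) j) j) i)"
proof (intro poly_eqI)
  fix a b
  have inner: "coeff (coeff (monom (monom c j) i) a) b = (if i = a then (if j
      = b then c else 0) else 0)"
    for c :: complex and i j by auto
  have "coeff (coeff (\<Sum>i\<le>N. \<Sum>j\<le>N. monom (monom (coeff (coeff P i) j) j) i) a) b
    = (\<Sum>i\<le>N. \<Sum>j\<le>N. if i = a then (if j = b then coeff (coeff P i) j else 0) else 0)"
    by (simp only: coeff_sum inner)
  also have "\<dots> = (\<Sum>i\<le>N. if i = a then (\<Sum>j\<le>N. if j = b then coeff (coeff P i) j else 0) else 0)"
  proof (rule sum.cong[OF refl])
    fix i show "(\<Sum>j\<le>N. if i = a then (if j = b then coeff (coeff P i) j else 0) else 0)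
      = (if i = a then (\<Sum>j\<le>N. if j = b then coeff (coeff P i) j else 0) else 0)"
      by (cases "i = a") simp_all
  qed
  also have "\<dots> = coeff (coeff P a) b"
    unfolding sum.delta[OF finite_atMost]
    using assms[unfolded deg_le_def, rule_format, of a b]
    by (cases "coeff (coeff P a) b = 0") auto
  finally show "coeff (coeff P a) b = coeff (coeff (\<Sum>i\<le>N. \<Sum>j\<le>N. monom (monom (coeff (coeff P i) j)
      j) i) a) b" ..
qed

lemma xy_subst_expand:
  assumes "deg_le N P"
  shows "xy_subst P F = (\<Sum>i\<le>N. \<Sum>j\<le>N. xyC (coeff (coeff P i) j) * snd F ^ j * fst F ^ i)"
proof -
  interpret comm_ring_hom "\<lambda>P. xy_subst P F" by (rule comm_ring_hom_xy_subst)
  have "xy_subst P F = xy_subst (\<Sum>i\<le>N. \<Sum>j\<le>N. monom (monom (coeff (coeff P i) j) j) i) F"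
    using xypoly_expand[OF assms] by simp
  then show ?thesis by (simp only: hom_sum xy_subst_monom)
qed

lemma deg_le_xy_subst:
  assumes P: "deg_le n P" and F: "deg_le m (fst F)" "deg_le m (snd F)"
  shows "deg_le (n * m) (xy_subst P F)"
  unfolding xy_subst_expand[OF P]
proof (intro deg_le_sum)
  fix i j
  show "deg_le (n * m) (xyC (coeff (coeff P i) j) * snd F ^ j * fst F ^ i)"
  proof (cases "coeff (coeff P i) j = 0")
    case True
    then show ?thesis by (simp add: deg_le_def)
  next
    case False
    then have "(0 + j * m) + i * m \<le> n * m"
      using P by (auto simp: deg_le_def add_mult_distrib[symmetric] add.commute)
    then show ?thesis by (rule deg_le_mono[rotated]) (intro deg_le_mult deg_le_const deg_le_power F)
  qed
qed

lemma deg_le_pmap_comp: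
  assumes "pmap_degree F \<le> n" "pmap_degree G \<le> m"
  shows "pmap_degree (F \<odot> G) \<le> n * m"
  using assms by (auto simp: pmap_degree_le_iff intro: deg_le_xy_subst)

lemma pmap_degree_tri:
  assumes "a \<noteq> 0" "b \<noteq> 0"
  shows "pmap_degree ([:P, [:a:]:], [:[:c, b:]:]) = max 1 (degree P)"
proof -
  have "deg_le n [:P, [:a:]:] \<longleftrightarrow> degree P \<le> n \<and> 1 \<le> n" for n
  proof
    assume *: "deg_le n [:P, [:a:]:]"
    from *[unfolded deg_le_def, rule_format, of 1 0] have "1 \<le> n" using assms(1) by simp
    moreover have "degree P \<le> n"
    proof (cases "P = 0")
      case False
      then show ?thesis using *[unfolded deg_le_def, rule_format, of 0 "degree P"] by simp
    qed simp
    ultimately show "degree P \<le> n \<and> 1 \<le> n" by simp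
  next
    assume "degree P \<le> n \<and> 1 \<le> n"
    then show "deg_le n [:P, [:a:]:]"
      by (auto simp: deg_le_def coeff_pCons split: nat.splits dest: le_degree)
  qed
  moreover have "deg_le n [:[:c, b:]:] \<longleftrightarrow> 1 \<le> n" for n
  proof
    assume "deg_le n [:[:c, b:]:]"
    from this[unfolded deg_le_def, rule_format, of 0 1] show "1 \<le> n" using assms(2) by simp
  qed (auto simp: deg_le_def coeff_pCons split: nat.splits)
  ultimately have "pmap_degree ([:P, [:a:]:], [:[:c, b:]:]) \<le> n \<longleftrightarrow> max 1 (degree P) \<le> n" for n
    by (auto simp: pmap_degree_le_iff)
  then show ?thesis by (meson le_refl order_antisym)
qed

section \<open>Coefficientwise limits as z tends to 0\<close>

text \<open>No bound on the degrees is built in; results that need one take it as an eventual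
  bound.\<close>

definition xy_tendsto :: "(complex \<Rightarrow> xypoly) \<Rightarrow> xypoly \<Rightarrow> bool" where
  "xy_tendsto P Q \<longleftrightarrow>
     (\<forall>i j. ((\<lambda>z. coeff (coeff (P z) i) j) \<longlongrightarrow> coeff (coeff Q i) j) (at 0))"

lemma xy_tendsto_const [intro, simp]: "xy_tendsto (\<lambda>_. Q) Q"
  by (simp add: xy_tendsto_def)

lemma xy_tendsto_add: "xy_tendsto P P0 \<Longrightarrow> xy_tendsto Q Q0 \<Longrightarrow> xy_tendsto (\<lambda>z. P z + Q z) (P0 + Q0)"
  by (auto simp: xy_tendsto_def intro: tendsto_add)

lemma xy_tendsto_mult: "xy_tendsto P P0 \<Longrightarrow> xy_tendsto Q Q0 \<Longrightarrow> xy_tendsto (\<lambda>z. P z * Q z) (P0 * Q0)"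
  by (auto simp: xy_tendsto_def coeff_mult coeff_sum intro!: tendsto_sum tendsto_mult)

lemma xy_tendsto_power: "xy_tendsto P P0 \<Longrightarrow> xy_tendsto (\<lambda>z. P z ^ n) (P0 ^ n)"
  by (induction n) (auto intro: xy_tendsto_mult)

lemma xy_tendsto_sum:
  "(\<And>i. i \<in> A \<Longrightarrow> xy_tendsto (P i) (Q i)) \<Longrightarrow> xy_tendsto (\<lambda>z. \<Sum>i\<in>A. P i z) (\<Sum>i\<in>A. Q i)"
  by (induction A rule: infinite_finite_induct) (auto intro: xy_tendsto_add)

lemma xy_tendsto_pCons:
  assumes "\<And>n. ((\<lambda>z. coeff (p z) n) \<longlongrightarrow> coeff q n) (at 0)"
  shows "xy_tendsto (\<lambda>z. [:p z:]) [:q:]"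
  unfolding xy_tendsto_def using assms by (auto simp: coeff_pCons split: nat.splits)

lemma xy_tendsto_xyC:
  assumes "(c \<longlongrightarrow> c0) (at 0)"
  shows "xy_tendsto (\<lambda>z. xyC (c z)) (xyC c0)"
  by (intro xy_tendsto_pCons) (use assms in \<open>auto simp: coeff_pCons split: nat.splits\<close>)

lemma xy_tendsto_cong:
  assumes "xy_tendsto P P0" "\<forall>\<^sub>F z in at 0. P z = Q z"
  shows "xy_tendsto Q P0"
  unfolding xy_tendsto_def
proof (intro allI)
  fix i j
  have "\<forall>\<^sub>F z in at 0. coeff (coeff (P z) i) j = coeff (coeff (Q z) i) j"
    using assms(2) by eventually_elim simp
  then show "((\<lambda>z. coeff (coeff (Q z) i) j) \<longlongrightarrow> coeff (coeff P0 i) j) (at 0)"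
    using assms(1) unfolding xy_tendsto_def by (metis Lim_transform_eventually)
qed

lemma xy_tendsto_deg_le:
  assumes "xy_tendsto P P0" "\<forall>\<^sub>F z in at 0. deg_le n (P z)"
  shows "deg_le n P0"
  unfolding deg_le_def
proof (intro allI impI)
  fix i j assume nz: "coeff (coeff P0 i) j \<noteq> 0"
  show "i + j \<le> n"
  proof (rule ccontr)
    assume "\<not> i + j \<le> n"
    then have "\<forall>\<^sub>F z in at 0. coeff (coeff (P z) i) j = 0"
      by (intro eventually_mono[OF assms(2)]) (auto simp: deg_le_def)
    then have "((\<lambda>z. coeff (coeff (P z) i) j) \<longlongrightarrow> 0) (at 0)" by (rule tendsto_eventually)
    with assms(1) have "coeff (coeff P0 i) j = 0"
      unfolding xy_tendsto_def by (metis tendsto_unique at_neq_bot)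
    with nz show False by contradiction
  qed
qed

text \<open>The common bound N turns substitution into a sum over a fixed finite index set, where
  the limit can be taken term by term.\<close>

lemma xy_tendsto_subst:
  assumes P: "xy_tendsto P P0" and N: "\<forall>\<^sub>F z in at 0. deg_le N (P z)"
    and F: "xy_tendsto (\<lambda>z. fst (F z)) (fst F0)" "xy_tendsto (\<lambda>z. snd (F z)) (snd F0)"
  shows "xy_tendsto (\<lambda>z. xy_subst (P z) (F z)) (xy_subst P0 F0)"
proof (rule xy_tendsto_cong)
  show "\<forall>\<^sub>F z in at 0. (\<Sum>i\<le>N. \<Sum>j\<le>N. xyC (coeff (coeff (P z) i) j) * snd (F z) ^ j * fst (F z) ^ i)
      = xy_subst (P z) (F z)"
    using N by eventually_elim (simp only: xy_subst_expand)
  show "xy_tendsto (\<lambda>z. \<Sum>i\<le>N. \<Sum>j\<le>N. xyC (coeff (coeff (P z) i) j) * snd (F z) ^ j * fst (F z) ^ i)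
    (xy_subst P0 F0)"
    unfolding xy_subst_expand[OF xy_tendsto_deg_le[OF P N]]
    using P by (intro xy_tendsto_sum xy_tendsto_mult xy_tendsto_power xy_tendsto_xyC F) (simp add:
        xy_tendsto_def)
qed

text \<open>The degree bound keeps the family in a single \<open>GA_upto n\<close>, where a closed
  set is cut out by polynomial equations in the coefficients, and these are continuous. Closedness
  is relative to \<open>GA\<close>, so the limit must be known to be an automorphism.\<close>

theorem ind_closure_limit:
  assumes A: "\<forall>\<^sub>F z in at 0. F z \<in> A" and n: "\<forall>\<^sub>F z in at 0. pmap_degree (F z) \<le> n"
    and lim: "xy_tendsto (\<lambda>z. fst (F z)) (fst F0)" "xy_tendsto (\<lambda>z. snd (F z)) (snd F0)"
    and F0: "F0 \<in> GA"
  shows "F0 \<in> ind_closure A"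
  unfolding hull_def
proof (rule InterI)
  fix C assume "C \<in> {C. ind_closed C \<and> A \<subseteq> C}"
  then have C: "ind_closed C" "A \<subseteq> C" by auto
  then obtain Z where Z: "zariski_closed n Z" "C \<inter> GA_upto n = Z \<inter> GA_upto n" and CGA: "C \<subseteq> GA"
    unfolding ind_closed_def by blast
  from Z(1) obtain S :: "(coord, complex) mpol set"
    where S: "Z = {F \<in> pmaps_upto n. \<forall>p\<in>S. mpol_eval (pmap_coord F) p = 0}"
    unfolding zariski_closed_def by blast
  have "deg_le n (fst F0)" "deg_le n (snd F0)"
    using n by (auto intro!: xy_tendsto_deg_le[OF lim(1)] xy_tendsto_deg_le[OF lim(2)]
        elim!: eventually_mono simp: pmap_degree_le_iff)
  then have deg: "pmap_degree F0 \<le> n" by (simp add: pmap_degree_le_iff)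
  have FZ: "\<forall>\<^sub>F z in at 0. F z \<in> Z"
    using A n by eventually_elim (use Z(2) C(2) CGA in \<open>auto simp: GA_upto_def\<close>)
  have coord: "((\<lambda>z. pmap_coord (F z) v) \<longlongrightarrow> pmap_coord F0 v) (at 0)" for v
    using lim by (cases v) (auto simp: xy_tendsto_def)
  have "mpol_eval (pmap_coord F0) p = 0" if "p \<in> S" for p
  proof -
    have "((\<lambda>z. mpol_eval (pmap_coord (F z)) p) \<longlongrightarrow> mpol_eval (pmap_coord F0) p) (at 0)"
      unfolding mpol_eval_def
      by (intro tendsto_sum tendsto_mult tendsto_prod tendsto_power tendsto_const coord)
    moreover have "((\<lambda>z. mpol_eval (pmap_coord (F z)) p) \<longlongrightarrow> 0) (at 0)"
      by (rule tendsto_eventually) (use FZ in eventually_elim, use S that in auto)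
    ultimately show ?thesis by (metis tendsto_unique at_neq_bot)
  qed
  then have "F0 \<in> Z" using S deg by (simp add: pmaps_upto_def)
  moreover have "F0 \<in> GA_upto n" using F0 deg by (simp add: GA_upto_def)
  ultimately show "F0 \<in> C" using Z(2) by blast
qed

section \<open>The approximate factorization of Y\<close>

lemma coeff_power_tendsto:
  fixes p :: "'b \<Rightarrow> complex poly"
  assumes "\<And>n. ((\<lambda>z. coeff (p z) n) \<longlongrightarrow> coeff q n) F"
  shows "((\<lambda>z. coeff (p z ^ j) n) \<longlongrightarrow> coeff (q ^ j) n) F"
proof (induction j arbitrary: n)
  case (Suc j)
  then show ?case by (auto simp: coeff_mult intro!: tendsto_sum tendsto_mult assms)
qed simp

lemma coeff_X_power: "coeff ([:0, 1:] ^ j :: 'a::comm_semiring_1 poly) n = (if n = j then 1 else 0)"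
  using coeff_monom[of "1::'a" j n] by (simp add: monom_altdef)

lemma poly_expand_le:
  fixes p :: "'a::comm_semiring_1 poly"
  assumes "degree p \<le> d"
  shows "poly p x = (\<Sum>i\<le>d. coeff p i * x ^ i)"
  unfolding poly_altdef by (rule sum.mono_neutral_left) (use assms in \<open>auto simp: coeff_eq_0\<close>)

lemma map_poly_xyC_expand:
  assumes "degree q \<le> d"
  shows "poly (map_poly xyC q) W = (\<Sum>j\<le>d. xyC (coeff q j) * W ^ j)"
proof -
  have "degree (map_poly xyC q) \<le> d" using degree_map_poly_le assms by (rule order_trans)
  then show ?thesis by (simp add: poly_expand_le coeff_map_poly)
qed

lemma coeff_pcompose_expand:
  fixes q f :: "complex poly"
  assumes "degree q \<le> d"
  shows "coeff (pcompose q f) n = (\<Sum>j\<le>d. coeff q j * coeff (f ^ j) n)"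
proof -
  have pow: "[:f:] ^ j = [:f ^ j:]" for j by (induction j) (simp_all add: one_pCons)
  have "[:pcompose q f:] = (\<Sum>j\<le>d. xyC (coeff q j) * [:f:] ^ j)"
    unfolding map_poly_xyC_pcompose[symmetric] by (rule map_poly_xyC_expand[OF assms])
  then have "coeff [:pcompose q f:] 0 = (\<Sum>j\<le>d. smult (coeff q j) (f ^ j))"
    by (simp add: coeff_sum pow)
  then show ?thesis by (simp add: coeff_sum)
qed

text \<open>Let G be the inverse series of f and q the sum of (G_j + t r_j) Y^j over j \<le> d.
  Since G(f) = Y, the difference q(f) - Y is t times the sum of r_j f^j over j \<le> d minus the sum
  of G_j f^j over j > d. Divide by t: f^j tends to Y^j, r_j is free, and G_j / t has the limit
  arranged by the curve.\<close>

lemma approximate_factorization: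
  fixes P :: "complex poly"
  assumes de: "d \<ge> 2" "e \<ge> 1" and pic: "PIC d e" and degP: "degree P = d + e"
  obtains s f q where "s \<noteq> 0"
    "\<forall>\<^sub>F z in at 0. degree (f z) = e + 1" "\<forall>\<^sub>F z in at 0. degree (q z) = d"
    "\<And>n. ((\<lambda>z. coeff (f z) n) \<longlongrightarrow> coeff [:0, 1:] n) (at 0)"
    "\<And>n. ((\<lambda>z. coeff (q z) n) \<longlongrightarrow> coeff [:0, 1:] n) (at 0)"
    "\<And>n. ((\<lambda>z. s / z ^ (d + e - 1) * coeff (pcompose (q z) (f z) - [:0, 1:]) n)
        \<longlongrightarrow> coeff P n) (at (0::complex))"
proof -
  obtain \<gamma> where \<gamma>: "\<gamma> \<noteq> 0" and curve:
    "\<And>c :: nat \<Rightarrow> complex. \<exists>y. (\<forall>i\<ge>1. ((\<lambda>z. y z i) \<longlongrightarrow> 0) (at 0))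
      \<and> (\<forall>\<^sub>F z in at 0. y z e \<noteq> 0)
      \<and> (\<forall>k\<ge>1. ((\<lambda>z. g_val e k (y z)) \<longlongrightarrow> 0) (at 0))
      \<and> (\<forall>k\<ge>d. ((\<lambda>z. g_val e k (y z) / z ^ (d + e - 1)) \<longlongrightarrow>
          (if k < d + e - 1 then c k else if k = d + e - 1 then \<gamma> else 0)) (at 0))"
    by (rule PIC_curve[OF de pic], rule that)
  \<comment> \<open>Coefficient d+e of the limit is - s \<gamma>; this s makes it the one of
    P.\<close>
  define s where "s = - (coeff P (d + e) / \<gamma>)"
  have "coeff P (d + e) \<noteq> 0" using degP de
      by (metis add_is_0 degree_0 leading_coeff_0_iff not_one_le_zero)
  then have s0: "s \<noteq> 0" using \<gamma> by (simp add: s_def)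
  \<comment> \<open>g_k is coefficient k+1 of the inverse, hence \<open>Suc k\<close>; the sign is
    that of the tail subtracted from q(f) - Y.\<close>
  define c where "c k = - (coeff P (Suc k) / s)" for k
  from curve[of c] obtain y where H1: "\<forall>i\<ge>1. ((\<lambda>z. y z i) \<longlongrightarrow> 0) (at 0)"
    and ye: "\<forall>\<^sub>F z in at 0. y z e \<noteq> 0"
    and H2: "\<forall>k\<ge>1. ((\<lambda>z. g_val e k (y z)) \<longlongrightarrow> 0) (at 0)"
    and H3: "\<forall>k\<ge>d. ((\<lambda>z. g_val e k (y z) / z ^ (d + e - 1)) \<longlongrightarrow>
          (if k < d + e - 1 then c k else if k = d + e - 1 then \<gamma> else 0)) (at 0)"
    by (elim exE conjE)
  note y0 = H1[rule_format] and g0 = H2[rule_format] and glim = H3[rule_format]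
  define t :: "complex \<Rightarrow> complex" where "t z = z ^ (d + e - 1)" for z
  have "(0::complex) ^ (d + e - 1) = 0" using de by (intro zero_power) simp
  moreover have "(t \<longlongrightarrow> 0 ^ (d + e - 1)) (at 0)"
    unfolding t_def by (intro tendsto_power tendsto_ident_at)
  ultimately have t0: "(t \<longlongrightarrow> 0) (at 0)" by (simp only:)
  define F where "F z = fps_X * base_fps e (y z)" for z
  define G where "G z = fps_nth (fps_inv (F z))" for z
  have G0: "G z 0 = 0" for z by (simp add: G_def fps_inv_def)
  have G_Suc: "G z (Suc k) = g_val e k (y z)" for z k by (simp add: G_def F_def g_val_eq_fps_inv)
  have G1: "G z (Suc 0) = 1" for z by (simp add: G_Suc g_val_def base_fps_nth)
  have Glim: "((\<lambda>z. G z j / t z) \<longlongrightarrow> - (coeff P j / s)) (at 0)" if j: "j > d" for j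
  proof -
    obtain k where k: "j = Suc k" "k \<ge> d" using j by (cases j) auto
    have "(if k < d + e - 1 then c k else if k = d + e - 1 then \<gamma> else 0) = - (coeff P j / s)"
    proof -
      consider "k < d + e - 1" | "k = d + e - 1" | "k > d + e - 1" by linarith
      then show ?thesis
      proof cases
        case 2
        then have "j = d + e" using k de by simp
        with 2 \<gamma> \<open>coeff P (d + e) \<noteq> 0\<close> show ?thesis by (simp add: s_def)
      next
        case 3
        then have "coeff P j = 0" using k degP by (intro coeff_eq_0) simp
        with 3 show ?thesis by simp
      qed (simp add: k c_def)
    qed
    with glim[OF k(2)] show ?thesis by (simp add: k(1) G_Suc t_def)
  qed
  \<comment> \<open>The summand z is switched on only when coefficient d of q would otherwise
    vanish; it keeps the degree of q equal to d and tends to 0.\<close>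
  define \<rho> where "\<rho> z = coeff P d / s + (if G z d + t z * (coeff P d / s) = 0 then z else 0)" for z
  have "((\<lambda>z. if G z d + t z * (coeff P d / s) = 0 then z else 0) \<longlongrightarrow> 0) (at 0)"
    by (rule metric_tendsto_imp_tendsto[OF tendsto_ident_at]) (auto intro!: always_eventually)
  then have \<rho>: "(\<rho> \<longlongrightarrow> coeff P d / s) (at 0)"
    unfolding \<rho>_def using tendsto_add[OF tendsto_const] by fastforce
  define r where "r z j = (if j = d then \<rho> z else coeff P j / s)" for z j
  have rlim: "((\<lambda>z. r z j) \<longlongrightarrow> coeff P j / s) (at 0)" for j
    using \<rho> by (cases "j = d") (simp_all add: r_def)
  define q where "q z = (\<Sum>j\<le>d. monom (G z j + t z * r z j) j)" for z
  define f where "f z = (\<Sum>i\<le>e. monom (fps_nth (base_fps e (y z)) i) (Suc i))" for z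
  have qc: "coeff (q z) n = (if n \<le> d then G z n + t z * r z n else 0)" for z n
    by (simp add: q_def coeff_sum)
  have fc: "coeff (f z) n = fps_nth (F z) n" for z n
    by (cases n) (simp_all add: f_def F_def coeff_sum base_fps_nth)
  have fF: "fps_of_poly (f z) = F z" for z by (rule fps_ext) (simp only: fps_of_poly_nth fc)
  have degq: "degree (q z) \<le> d" for z by (rule degree_le) (simp add: qc)
  have dq: "\<forall>\<^sub>F z in at 0. degree (q z) = d"
  proof -
    have "\<forall>\<^sub>F z in at (0::complex). z \<noteq> 0" by (simp add: eventually_at_filter)
    then show ?thesis
    proof eventually_elim
      case (elim z)
      have "coeff (q z) d = (G z d + t z * (coeff P d / s))
        + (if G z d + t z * (coeff P d / s) = 0 then t z * z else 0)"
        by (simp add: qc r_def \<rho>_def distrib_left)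
      moreover have "t z * z \<noteq> 0" using elim by (simp add: t_def)
      ultimately have "coeff (q z) d \<noteq> 0" by (simp split: if_splits)
      then show ?case using degq[of z] by (intro order_antisym le_degree)
    qed
  qed
  have df: "\<forall>\<^sub>F z in at 0. degree (f z) = e + 1"
    using ye
  proof eventually_elim
    case (elim z)
    have "coeff (f z) (e + 1) \<noteq> 0" using elim de by (simp add: fc F_def base_fps_nth)
    moreover have "degree (f z) \<le> e + 1"
      by (rule degree_le) (auto simp: fc F_def base_fps_nth split: nat.splits)
    ultimately show ?case by (intro order_antisym le_degree)
  qed
  have flim: "((\<lambda>z. coeff (f z) n) \<longlongrightarrow> coeff [:0, 1:] n) (at 0)" for n
    unfolding fc F_def using y0
    by (cases "n - 1 \<le> e"; cases n) (auto simp: base_fps_nth coeff_pCons split: nat.splits)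
  have qlim: "((\<lambda>z. coeff (q z) n) \<longlongrightarrow> coeff [:0, 1:] n) (at 0)" for n
  proof (cases "n \<le> d")
    case True
    have "((\<lambda>z. G z n) \<longlongrightarrow> coeff [:0, 1:] n) (at 0)"
    proof (cases n)
      case (Suc k)
      show ?thesis
      proof (cases k)
        case 0
        then show ?thesis using Suc by (simp add: G1)
      next
        case (Suc l)
        then show ?thesis using \<open>n = Suc k\<close> g0[of k] by (simp add: G_Suc)
      qed
    qed (simp add: G0)
    moreover have "((\<lambda>z. t z * r z n) \<longlongrightarrow> 0 * (coeff P n / s)) (at 0)"
      by (intro tendsto_mult t0 rlim)
    ultimately have "((\<lambda>z. G z n + t z * r z n) \<longlongrightarrow> coeff [:0, 1:] n + 0 * (coeff P n / s)) (at 0)"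
      by (rule tendsto_add)
    with True show ?thesis by (simp add: qc)
  next
    case False
    then have "coeff [:0, 1::complex:] n = 0" using de by (intro coeff_eq_0) simp
    with False show ?thesis by (simp add: qc)
  qed
  have plim: "((\<lambda>z. s / z ^ (d + e - 1) * coeff (pcompose (q z) (f z) - [:0, 1:]) n)
      \<longlongrightarrow> coeff P n) (at 0)" for n
  proof -
    let ?\<phi> = "\<lambda>z j. coeff (f z ^ j) n"
    \<comment> \<open>Since f has no constant term, f^j contributes to coefficient n only for j
      \<le> n. Summing up to max n d is therefore exact and covers the range j \<le> d of q.\<close>
    let ?N = "max n d"
    have \<phi>F: "?\<phi> z j = fps_nth (F z ^ j) n" for z j
      by (metis fF fps_of_poly_nth fps_of_poly_power)
    have \<phi>lim: "((\<lambda>z. ?\<phi> z j) \<longlongrightarrow> (if n = j then 1 else 0)) (at 0)" for j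
      using coeff_power_tendsto[OF flim, of j n] by (simp only: coeff_X_power)
    have inv: "(\<Sum>j\<le>?N. G z j * ?\<phi> z j) = coeff [:0, 1:] n" for z
    proof -
      have "fps_inv (F z) oo F z = fps_X" by (rule fps_inv) (auto simp: F_def base_fps_nth)
      then have "(\<Sum>j=0..n. G z j * fps_nth (F z ^ j) n) = fps_nth fps_X n"
        unfolding G_def by (metis fps_compose_nth)
      also have "fps_nth fps_X n = coeff [:0, 1::complex:] n"
        by (auto simp: fps_X_def coeff_pCons split: nat.splits)
      also have "(\<Sum>j=0..n. G z j * fps_nth (F z ^ j) n) = (\<Sum>j\<le>?N. G z j * ?\<phi> z j)"
        unfolding \<phi>F
        by (rule sum.mono_neutral_left) (auto simp: F_def power_mult_distrib fps_X_power_mult_nth)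
      finally show ?thesis .
    qed
    have split: "{..?N} = {..d} \<union> {d<..?N}" "{..d} \<inter> {d<..?N} = {}" by auto
    have eq: "s / t z * coeff (pcompose (q z) (f z) - [:0, 1:]) n
      = s * ((\<Sum>j\<le>d. r z j * ?\<phi> z j) - (\<Sum>j\<in>{d<..?N}. G z j / t z * ?\<phi> z j))" if "z \<noteq> 0" for z
    proof -
      have tz: "t z \<noteq> 0" using that by (simp add: t_def)
      have "coeff (pcompose (q z) (f z)) n = (\<Sum>j\<le>d. (G z j + t z * r z j) * ?\<phi> z j)"
        unfolding coeff_pcompose_expand[OF degq] by (intro sum.cong) (auto simp: qc)
      also have "\<dots> = (\<Sum>j\<le>d. G z j * ?\<phi> z j) + t z * (\<Sum>j\<le>d. r z j * ?\<phi> z j)"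
        by (simp add: distrib_right sum.distrib sum_distrib_left mult.assoc)
      also have "(\<Sum>j\<le>d. G z j * ?\<phi> z j) = coeff [:0, 1:] n - (\<Sum>j\<in>{d<..?N}. G z j * ?\<phi> z j)"
        unfolding inv[symmetric, of z] split(1) using split(2) by (subst sum.union_disjoint) auto
      also have "(\<Sum>j\<in>{d<..?N}. G z j * ?\<phi> z j) = t z * (\<Sum>j\<in>{d<..?N}. G z j / t z * ?\<phi> z j)"
        using tz by (simp add: sum_distrib_left)
      finally have "coeff (pcompose (q z) (f z) - [:0, 1:]) n
        = t z * ((\<Sum>j\<le>d. r z j * ?\<phi> z j) - (\<Sum>j\<in>{d<..?N}. G z j / t z * ?\<phi> z j))"
        unfolding coeff_diff by (simp only: right_diff_distrib) simp
      then show ?thesis using tz by simp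
    qed
    have "((\<lambda>z. s * ((\<Sum>j\<le>d. r z j * ?\<phi> z j) - (\<Sum>j\<in>{d<..?N}. G z j / t z * ?\<phi> z j))) \<longlongrightarrow>
      s * ((\<Sum>j\<le>d. coeff P j / s * (if n = j then 1 else 0))
        - (\<Sum>j\<in>{d<..?N}. - (coeff P j / s) * (if n = j then 1 else 0)))) (at 0)"
      by (intro tendsto_mult tendsto_const tendsto_diff tendsto_sum rlim \<phi>lim Glim) simp
    also have "s * ((\<Sum>j\<le>d. coeff P j / s * (if n = j then 1 else 0))
        - (\<Sum>j\<in>{d<..?N}. - (coeff P j / s) * (if n = j then 1 else 0))) = coeff P n"
      using s0 by (cases "n \<le> d") (simp_all add: if_distrib[of
          "(*) _"] sum.delta' sum_negf cong: if_cong)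
    finally have "((\<lambda>z. s * ((\<Sum>j\<le>d. r z j * ?\<phi> z j)
      - (\<Sum>j\<in>{d<..?N}. G z j / t z * ?\<phi> z j))) \<longlongrightarrow> coeff P n) (at 0)" .
    moreover have "\<forall>\<^sub>F z in at (0::complex). z \<noteq> 0" by (simp add: eventually_at_filter)
    then have "\<forall>\<^sub>F z in at 0. s * ((\<Sum>j\<le>d. r z j * ?\<phi> z j)
      - (\<Sum>j\<in>{d<..?N}. G z j / t z * ?\<phi> z j))
      = s / z ^ (d + e - 1) * coeff (pcompose (q z) (f z) - [:0, 1:]) n"
      unfolding t_def[symmetric] by (rule eventually_mono) (rule eq[symmetric])
    ultimately show ?thesis by (rule Lim_transform_eventually)
  qed
  show ?thesis by (rule that[OF s0 df dq flim qlim plim])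
qed

section \<open>The family of polydegree (d, e+1) and its limit\<close>

lemma GA_polydegree_single:
  assumes "F \<in> GA_polydegree [m]"
  obtains A T B where "F = A \<odot> T \<odot> B" "A \<in> Aff" "B \<in> Aff" "T \<in> Tri - Aff" "pmap_degree T = m"
proof -
  from assms obtain \<tau> \<alpha> where "F = foldl (\<lambda>F i. F \<odot> \<tau> i \<odot> \<alpha> i) (\<alpha> 0) [1..<Suc (length [m])]"
    "\<forall>i\<in>{0..length [m]}. \<alpha> i \<in> Aff" "\<forall>i\<in>{1..length [m]}. \<tau> i \<in> Tri - Aff"
    "\<forall>i\<in>{1..length [m]}. pmap_degree (\<tau> i) = [m] ! (i - 1)"
    unfolding GA_polydegree_def mem_Collect_eq by (elim exE conjE)
  then show ?thesis using that[of "\<alpha> 0" "\<tau> 1" "\<alpha> 1"] by simp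
qed

lemma GA_polydegree_pairI:
  assumes "A \<in> Aff" "B \<in> Aff" "C \<in> Aff" "B \<notin> Tri" "S \<in> Tri - Aff" "T \<in> Tri - Aff"
    "pmap_degree S = m" "pmap_degree T = n"
  shows "A \<odot> S \<odot> B \<odot> T \<odot> C \<in> GA_polydegree [m, n]"
proof -
  let ?\<alpha> = "\<lambda>i::nat. if i = 0 then A else if i = 1 then B else C" and ?\<tau> = "\<lambda>i::nat. if i
      = 1 then S else T"
  have "[1..<Suc (length [m, n])] = [1, 2]" by (simp add: upt_rec)
  then have "A \<odot> S \<odot> B \<odot> T \<odot> C = foldl (\<lambda>F i. F \<odot> ?\<tau> i \<odot> ?\<alpha> i) (?\<alpha> 0) [1..<Suc (length [m, n])]"
    by simp
  moreover have "pmap_degree (?\<tau> i) = [m, n] ! (i - 1)" if "i \<in> {1..length [m, n]}" for i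
  proof -
    from that have "i = 1 \<or> i = 2" by auto
    then show ?thesis using assms(7,8) by auto
  qed
  ultimately show ?thesis unfolding GA_polydegree_def mem_Collect_eq
    by (intro exI[of _ ?\<tau>] exI[of _ ?\<alpha>] conjI) (use assms in auto)
qed

lemma xy_swap_Aff: "(xyY, xyX) \<in> Aff" and xy_swap_not_Tri: "(xyY, xyX) \<notin> Tri"
proof -
  have "(xyY, xyX) \<odot> (xyY, xyX) = pmap_id"
    by (simp only: pmap_comp_def xy_subst_X xy_subst_Y fst_conv snd_conv pmap_id_def)
  then have "(xyY, xyX) \<in> GA" unfolding GA_def by blast
  moreover have "pmap_degree (xyY, xyX) \<le> n \<longleftrightarrow> 1 \<le> n" for n
  proof
    assume "pmap_degree (xyY, xyX) \<le> n"
    then have "deg_le n xyX" by (simp add: pmap_degree_le_iff)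
    from this[unfolded deg_le_def, rule_format, of 1 0] show "1 \<le> n" by simp
  qed (auto simp: pmap_degree_le_iff deg_le_def coeff_pCons split: nat.splits)
  then have "pmap_degree (xyY, xyX) = 1" by (meson le_refl order_antisym)
  ultimately show "(xyY, xyX) \<in> Aff" by (simp add: Aff_def)
  show "(xyY, xyX) \<notin> Tri" by (auto simp: Tri_def)
qed

text \<open>The composition \<open>\<tau>\<^sub>1 \<circ> swap \<circ> \<tau>\<^sub>2\<close> has first component \<open>u \<cdot> (q(w) - Y)\<close> with \<open>w = f(Y)
    + v X\<close>; the
  terms of positive degree in \<open>X\<close> are split off by \<open>w\<^sup>j - f\<^sup>j = v X \<cdot> (\<dots>)\<close>.\<close>

lemma swap_composition:
  assumes "degree q \<le> d"
  shows "fst (([:smult u q, [:- u:]:], R) \<odot> (xyY, xyX) \<odot> ([:f, [:v:]:], [:[:0, 1:]:]))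
    = [:smult u (pcompose q f - [:0, 1:]):] + xyC (u * v) * (xyX *
      (\<Sum>j\<le>d. xyC (coeff q j) * (\<Sum>i<j. [:f:] ^ (j - Suc i) * ([:f:] + xyC v * xyX) ^ i)))"
    (is "?L = _ + _ * (_ * ?S)")
    and "snd ((Q, [:[:c, b:]:]) \<odot> (xyY, xyX) \<odot> ([:f, [:v:]:], [:[:0, 1:]:])) = xyC c
        + xyC b * ([:f:] + xyC v * xyX)"
proof -
  let ?W = "[:f:] + xyC v * xyX"
  have W: "(xyY, xyX) \<odot> ([:f, [:v:]:], [:[:0, 1:]:]) = (xyY, ?W)"
    by (simp only: pmap_comp_def xy_subst_X xy_subst_Y fst_conv snd_conv) simp
  show "snd ((Q, [:[:c, b:]:]) \<odot> (xyY, xyX) \<odot> ([:f, [:v:]:], [:[:0, 1:]:])) = xyC c + xyC b * ?W"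
    by (simp only: pmap_comp_assoc W pmap_comp_simps snd_conv xy_subst_tri2)
  have C: "xyC (x * y) = xyC x * xyC y" for x y by simp
  have deg: "degree (smult u q) \<le> d" using degree_smult_le assms by (rule order_trans)
  have "?L = poly (map_poly xyC (smult u q)) ?W + xyC (- u) * xyY"
    by (simp only: pmap_comp_assoc W pmap_comp_simps fst_conv snd_conv xy_subst_tri1)
  also have "poly (map_poly xyC (smult u q)) ?W = (\<Sum>j\<le>d. xyC (u * coeff q j) * ?W ^ j)"
    by (simp only: map_poly_xyC_expand[OF deg] coeff_smult)
  also have "\<dots> = (\<Sum>j\<le>d. xyC (u * coeff q j) * [:f:] ^ j)
      + (\<Sum>j\<le>d. xyC (u * coeff q j) * (?W ^ j - [:f:] ^ j))"
    by (simp only: sum.distrib[symmetric] distrib_left[symmetric] add_diff_cancel_left'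
        diff_add_cancel add_diff_inverse add.commute[of "[:f:] ^ _"])
  also have "(\<Sum>j\<le>d. xyC (u * coeff q j) * [:f:] ^ j) = [:smult u (pcompose q f):]"
    unfolding pcompose_smult[symmetric] map_poly_xyC_pcompose[symmetric] map_poly_xyC_expand[OF
        deg] coeff_smult ..
  also have "(\<Sum>j\<le>d. xyC (u * coeff q j) * (?W ^ j - [:f:] ^ j)) = xyC (u * v) * (xyX * ?S)"
    unfolding power_diff_sumr2 add_diff_cancel_left' sum_distrib_left C
    by (intro sum.cong refl) (simp only: mult_ac)
  finally show "?L = [:smult u (pcompose q f - [:0, 1:]):] + xyC (u * v) * (xyX * ?S)"
    by (simp add: smult_diff_right)
qed

theorem theorem3:
  fixes d e :: nat
  assumes "d \<ge> 2" and "e \<ge> 1"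
    and "PIC d e"
  shows "GA_polydegree [d + e] \<subseteq> ind_closure (GA_polydegree [d, e + 1])"
proof
  fix \<theta> assume "\<theta> \<in> GA_polydegree [d + e]"
  then obtain A T B where \<theta>: "\<theta> = A \<odot> T \<odot> B" and A: "A \<in> Aff" and B: "B \<in> Aff"
    and T: "T \<in> Tri - Aff" "pmap_degree T = d + e" by (rule GA_polydegree_single)
  then obtain a b c P where T_eq: "T = ([:P, [:a:]:], [:[:c, b:]:])" and ab: "a \<noteq> 0" "b \<noteq> 0"
    by (auto simp: Tri_def)
  have "max 1 (degree P) = d + e" using T(2) pmap_degree_tri[OF ab] by (simp add: T_eq)
  then have "degree P = d + e" using assms(1) by (auto simp: max_def split: if_splits)
  obtain s f q where s: "s \<noteq> 0"
    and f: "\<forall>\<^sub>F z in at 0. degree (f z) = e + 1" and q: "\<forall>\<^sub>F z in at 0. degree (q z) = d"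
    and flim: "\<And>n. ((\<lambda>z. coeff (f z) n) \<longlongrightarrow> coeff [:0, 1:] n) (at 0)"
    and qlim: "\<And>n. ((\<lambda>z. coeff (q z) n) \<longlongrightarrow> coeff [:0, 1:] n) (at 0)"
    and Plim: "\<And>n. ((\<lambda>z. s / z ^ (d + e - 1) * coeff (pcompose (q z) (f z) - [:0, 1:]) n)
        \<longlongrightarrow> coeff P n) (at (0::complex))"
    by (rule approximate_factorization[OF assms \<open>degree P = d + e\<close>], rule that)
  \<comment> \<open>u v = a is the constant X-coefficient of T, although u blows up and v tends to
    0; u is the factor that rescales q(f) - Y to P.\<close>
  define u where "u z = s / z ^ (d + e - 1)" for z :: complex
  define v where "v z = z ^ (d + e - 1) * (a / s)" for z :: complex
  define T1 where "T1 z = ([:smult (u z) (q z), [:- u z:]:], [:[:c, b:]:])" for z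
  define T2 where "T2 z = ([:f z, [:v z:]:], [:[:0, 1:]:] :: xypoly)" for z
  define M where "M z = T1 z \<odot> (xyY, xyX) \<odot> T2 z" for z
  have nz: "\<forall>\<^sub>F z in at (0::complex). z \<noteq> 0" by (simp add: eventually_at_filter)
  have T1: "\<forall>\<^sub>F z in at 0. T1 z \<in> Tri - Aff \<and> pmap_degree (T1 z) = d"
    using q nz
  proof eventually_elim
    case (elim z)
    then have u: "- u z \<noteq> 0" using s by (simp add: u_def)
    then have "pmap_degree (T1 z) = d"
      unfolding T1_def using elim assms(1) by (subst pmap_degree_tri[OF u ab(2)]) simp
    moreover have "T1 z \<in> Tri" unfolding T1_def Tri_def using u ab by blast
    ultimately show ?case using assms(1) by (auto simp: Aff_def)
  qed
  have T2: "\<forall>\<^sub>F z in at 0. T2 z \<in> Tri - Aff \<and> pmap_degree (T2 z) = e + 1"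
    using f nz
  proof eventually_elim
    case (elim z)
    then have v: "v z \<noteq> 0" using s ab by (simp add: v_def)
    then have "pmap_degree (T2 z) = e + 1"
      unfolding T2_def using elim by (subst pmap_degree_tri) auto
    moreover have "T2 z \<in> Tri" unfolding T2_def Tri_def using v one_neq_zero by blast
    ultimately show ?case using assms(2) by (auto simp: Aff_def)
  qed
  \<comment> \<open>This bound, independent of z, keeps the whole family in one finite-dimensional
    piece of the ind-variety.\<close>
  have M_deg: "\<forall>\<^sub>F z in at 0. pmap_degree (M z) \<le> d * 1 * (e + 1)"
    using T1 T2
  proof eventually_elim
    case (elim z)
    then show ?case
      unfolding M_def using xy_swap_Aff by (intro deg_le_pmap_comp) (simp_all add: Aff_def)
  qed
  have "(0::complex) ^ (d + e - 1) = 0" using assms(1) by (intro zero_power) simp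
  moreover have "(v \<longlongrightarrow> 0 ^ (d + e - 1) * (a / s)) (at 0)"
    unfolding v_def by (intro tendsto_mult tendsto_power tendsto_ident_at tendsto_const)
  ultimately have v0: "(v \<longlongrightarrow> 0) (at 0)" by (simp only: mult_zero_left)
  have f_lim: "xy_tendsto (\<lambda>z. [:f z:]) xyY" by (intro xy_tendsto_pCons flim)
  have W_lim: "xy_tendsto (\<lambda>z. [:f z:] + xyC (v z) * xyX) xyY"
  proof -
    have "xy_tendsto (\<lambda>z. [:f z:] + xyC (v z) * xyX) (xyY + xyC 0 * xyX)"
      by (intro xy_tendsto_add f_lim xy_tendsto_mult xy_tendsto_xyC v0 xy_tendsto_const)
    also have "xyY + xyC 0 * xyX = xyY" by simp
    finally show ?thesis .
  qed
  \<comment> \<open>In the limit q, f and W all become Y, so only j = 1 contributes and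
    \<open>?S\<close> tends to 1: what remains of the terms divisible by X is a X.\<close>
  let ?S = "\<lambda>z. \<Sum>j\<le>d. xyC (coeff (q z) j) * (\<Sum>i<j. [:f z:] ^ (j - Suc i) * ([:f z:]
      + xyC (v z) * xyX) ^ i)"
  have "xy_tendsto ?S (\<Sum>j\<le>d. xyC (coeff [:0, 1:] j) * (\<Sum>i<j. xyY ^ (j - Suc i) * xyY ^ i))"
    by (intro xy_tendsto_sum xy_tendsto_mult xy_tendsto_power xy_tendsto_xyC f_lim W_lim qlim)
  also have "(\<Sum>j\<le>d. xyC (coeff [:0, 1:] j) * (\<Sum>i<j. xyY ^ (j - Suc i) * xyY ^ i))
    = (\<Sum>j\<le>d. if j = 1 then 1 else 0)"
    by (intro sum.cong refl) (auto simp: coeff_pCons one_pCons split: nat.splits)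
  also have "\<dots> = 1" using assms(1) by (simp add: sum.delta')
  finally have S_lim: "xy_tendsto ?S 1" .
  have "xy_tendsto (\<lambda>z. [:smult (u z) (pcompose (q z) (f z) - [:0, 1:]):]) [:P:]"
    using Plim by (intro xy_tendsto_pCons) (simp add: u_def)
  from xy_tendsto_add[OF this xy_tendsto_mult[OF xy_tendsto_const[of
      "xyC a"] xy_tendsto_mult[OF xy_tendsto_const[of xyX] S_lim]]]
  have "xy_tendsto (\<lambda>z. [:smult (u z) (pcompose (q z) (f z) - [:0, 1:]):]
      + xyC a * (xyX * ?S z)) (fst T)"
    by (simp add: T_eq)
  then have M1: "xy_tendsto (\<lambda>z. fst (M z)) (fst T)"
  proof (rule xy_tendsto_cong)
    show "\<forall>\<^sub>F z in at 0. [:smult (u z) (pcompose (q z) (f z) - [:0, 1:]):] + xyC a * (xyX * ?S z)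
        = fst (M z)"
      using q nz
    proof eventually_elim
      case (elim z)
      then have "u z * v z = a" using s by (simp add: u_def v_def)
      moreover have "degree (q z) \<le> d" using elim by simp
      ultimately show ?case unfolding M_def T1_def T2_def by (simp only: swap_composition(1))
    qed
  qed
  have "xy_tendsto (\<lambda>z. xyC c + xyC b * ([:f z:] + xyC (v z) * xyX)) (xyC c + xyC b * xyY)"
    by (intro xy_tendsto_add xy_tendsto_mult xy_tendsto_const W_lim)
  then have M2: "xy_tendsto (\<lambda>z. snd (M z)) (snd T)"
    unfolding M_def T1_def T2_def swap_composition(2)[OF order_refl] by (simp add: T_eq)
  have deg1: "pmap_degree A \<le> 1" "pmap_degree B \<le> 1" using A B by (auto simp: Aff_def)
  have AM_deg: "\<forall>\<^sub>F z in at 0. pmap_degree (A \<odot> M z) \<le> 1 * (d * 1 * (e + 1))"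
    using M_deg by eventually_elim (rule deg_le_pmap_comp[OF deg1(1)])
  have AM: "xy_tendsto (\<lambda>z. fst (A \<odot> M z)) (fst (A \<odot> T))"
      "xy_tendsto (\<lambda>z. snd (A \<odot> M z)) (snd (A \<odot> T))"
    unfolding pmap_comp_simps using deg1(1)
    by (intro xy_tendsto_subst[where N = 1] xy_tendsto_const M1 M2;
        simp add: pmap_degree_le_iff)+
  show "\<theta> \<in> ind_closure (GA_polydegree [d, e + 1])"
  proof (rule ind_closure_limit)
    show "\<forall>\<^sub>F z in at 0. A \<odot> M z \<odot> B \<in> GA_polydegree [d, e + 1]"
      using T1 T2
    proof eventually_elim
      case (elim z)
      have "A \<odot> M z \<odot> B = A \<odot> T1 z \<odot> (xyY, xyX) \<odot> T2 z \<odot> B"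
        by (simp only: M_def pmap_comp_assoc)
      also have "\<dots> \<in> GA_polydegree [d, e + 1]"
        by (intro GA_polydegree_pairI A B xy_swap_Aff xy_swap_not_Tri) (use elim in auto)
      finally show ?case .
    qed
    show "\<forall>\<^sub>F z in at 0. pmap_degree (A \<odot> M z \<odot> B) \<le> 1 * (d * 1 * (e + 1)) * 1"
      using AM_deg by eventually_elim (rule deg_le_pmap_comp[OF _ deg1(2)])
    show "xy_tendsto (\<lambda>z. fst (A \<odot> M z \<odot> B)) (fst \<theta>)" "xy_tendsto (\<lambda>z. snd (A \<odot> M z \<odot> B)) (snd \<theta>)"
      unfolding \<theta> pmap_comp_simps(1)[of "A \<odot> M _" B] pmap_comp_simps(2)[of "A \<odot> M _" B]
        pmap_comp_simps(1)[of "A \<odot> T" B] pmap_comp_simps(2)[of "A \<odot> T" B]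
      using AM_deg
      by (intro xy_tendsto_subst[where N = "1 * (d * 1 * (e + 1))"] xy_tendsto_const AM;
          auto elim!: eventually_mono simp: pmap_degree_le_iff)+
    show "\<theta> \<in> GA"
      unfolding \<theta> using A B T(1) Tri_subset_GA by (intro GA_comp) (auto simp: Aff_def)
  qed
qed

end
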